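(* Let $\pi\in\mathrm{int}(I_j)$. Then $$\hat v_b(\pi)=\max\{v_1^*,\;v_\ell^*,\;Val(B),\;v(\pi)\},\qquad\text{where } v(\pi)=u_S(a_j).$$
   Context: **Model.** The state space is $\Omega=\{0,1\}$ with common prior $\pi=\mathbf{P}(\omega=1)\in(0,1)$. The receiver has a finite action set $A=\{a_1,\dots,a_\ell\}$ and a utility $u_R:A\times\Omega\to\mathbb{R}$ and maximizes expected utility. There are cutoffs $0=x_0<x_1<\dots<x_\ell=1$ such that the set of beliefs (probabilities of $\omega=1$) at which $a_i$ is optimal is $I_i=[x_{i-1},x_i]$. The prior $\pi$ is fixed with $\pi\in\mathrm{int}(I_j)$. The sender has a state-independent utility $u_S:A\to\mathbb{R}$ (extended linearly to $\Delta(A)$) that is generic: $u_S(a)\neq u_S(b)$ for distinct $a,b\in A$. For a belief $\lambda$ in the interior of $I_i$, $v(\lambda)=u_S(a_i)$. **Information structures.** An information structure $F=(S,F_0,F_1)$ consists of a measurable space $S$ and two mutually absolutely continuous probability measures $F_0,F_1$ on $S$ (the distribution of the receiver's private signal in each state). Each signal $s$ is identified with the posterior probability of $\omega=1$ that it induces starting from prior $1/2$, so $S\subseteq(0,1)$. With $lr(\lambda)=\log\frac{\lambda}{1-\lambda}$, a belief $\lambda$ is updated after signal $s$ to $\lambda^s$ with $lr(\lambda^s)=lr(\lambda)+lr(s)$. The sender does not observe the receiver's signal; message and signal are conditionally independent given $\omega$. For $\delta>0$, $\mathcal F_\delta$ is the set of all information structures with support contained in $[\frac12-\delta,\frac12+\delta]$,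 and $\mathcal B_\delta\subset\mathcal F_\delta$ is the set of those with binary support (two distinct signals). **Equilibrium.** A sender strategy is $\sigma:\Omega\to\Delta(M)$ with $M\subseteq[0,1]$ finite; a receiver strategy is a measurable $\rho:M\times S\to\Delta(A)$. Together with $F$ and $\pi$ they generate a distribution $p$ on $\Omega\times M\times S$; messages are identified with the posteriors they induce, $p(\omega=1|m)=m$. The pair $(\sigma,\rho)$ is a cheap-talk equilibrium if (1) the support of $\rho(m,s)$ is contained in $\arg\max_{a\in A}\,p(\omega=1|m,s)u_R(a,1)+p(\omega=0|m,s)u_R(a,0)$; and (2) for every $m\in M$ and $\omega\in\Omega$ with $p(m|\omega)>0$, $\int_S u_S(\rho(m,s))\,dF_\omega(s)\ge\int_S u_S(\rho(m',s))\,dF_\omega(s)$ for every $m'$ that is sent with positive probability. **Values.** $v^*_F(\pi)$ is the sender's maximal ex-ante expected utility over all cheap-talk equilibria with information structure $F$ and prior $\pi$. The binary informationally robust equilibrium utility is $\hat v_b(\pi)=\lim_{\delta\to0}\inf_{F\in\mathcal B_\delta}v^*_F(\pi)$. **The set $Q$.** $Q$ is the set of quadruples $(a_i,a_{i+1},a_k,a_{k+1})\in A^4$ with $i\le j-1$, $k\ge j$, $i+1<k$ satisfying one of: 1. $u_S(a_i)<u_S(a_k)<u_S(a_{i+1})<u_S(a_{k+1})$; 2. $u_S(a_{k+1})<u_S(a_{i+1})<u_S(a_k)<u_S(a_i)$; 3. $u_S(a_k)<u_S(a_i)<u_S(a_{k+1})<u_S(a_{i+1})$; 4. $u_S(a_{i+1})<u_S(a_{k+1})<u_S(a_i)<u_S(a_k)$.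 **The matrix $B$.** Write $Q=\{\overline a_1,\dots,\overline a_q\}$. $B$ is the $q\times2$ matrix in which, for $\overline a_l=(a_i,a_{i+1},a_k,a_{k+1})$ of type 1 or 2, $B_{l,1}=u_S(a_k)$ and $B_{l,2}=u_S(a_{i+1})$, and for $\overline a_l$ of type 3 or 4, $B_{l,1}=u_S(a_i)$ and $B_{l,2}=u_S(a_{k+1})$. $Val(B)$ is the (mixed-strategy) value of the zero-sum game with payoff matrix $B$, where the row player maximizes and the column player minimizes. If $Q=\emptyset$, set $Val(B)=-\infty$. **The set $T$ and $v_1^*,v_\ell^*$.** $T$ is the set of triples, with $1<i<\ell$, of one of the forms: 1. $(a_1,a_i,a_{i+1})$ where $1<j\le i$ and $u_S(a_i)<u_S(a_1)<u_S(a_{i+1})$; 2. $(a_{i-1},a_i,a_\ell)$ where $i\le j<\ell$ and $u_S(a_i)<u_S(a_\ell)<u_S(a_{i-1})$. $u_S(a_1)$ (resp. $u_S(a_\ell)$) is achievable if $T$ contains a triple of type 1 (resp. type 2). For $i\in\{1,\ell\}$, $v_i^*=u_S(a_i)$ if $u_S(a_i)$ is achievable and $v_i^*=-\infty$ otherwise. *)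

theory Defs
  imports "HOL-Probability.Probability"
begin

text \<open>
  The state space is \<^typ>\<open>bool\<close>, with \<^term>\<open>True\<close> for state 1 and \<^term>\<open>False\<close> for state 0.
  Beliefs are probabilities of \<^term>\<open>True\<close>.  The actions \<open>a\<^sub>1, \<dots>, a\<^sub>\<ell>\<close> are given by an
  enumeration \<open>act\<close> of the action set \<open>A\<close> by the indices \<open>1, \<dots>, \<ell>\<close>.
\<close>

definition weight :: "real \<Rightarrow> bool \<Rightarrow> real" where
  "weight b \<omega> = (if \<omega> then b else 1 - b)"

definition optimal_actions :: "'a set \<Rightarrow> ('a \<Rightarrow> bool \<Rightarrow> real) \<Rightarrow> real \<Rightarrow> 'a set" where
  "optimal_actions A uR b = {a. is_arg_max (\<lambda>a. b * uR a True + (1 - b) * uR a False) (\<lambda>a. a \<in> A) a}"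


section \<open>Information structures\<close>

text \<open>
  An information structure is a pair of measures \<open>F False\<close>, \<open>F True\<close> on a common set \<open>S\<close> of signals,
  recovered as \<open>space (F False)\<close>.  The last conjunct says that a signal is the posterior it induces
  from prior 1/2: for every event \<open>E\<close>, the probability that the state is 1 and the signal lies in
  \<open>E\<close> is the expectation of \<open>s\<close> over \<open>E\<close>.
\<close>

definition info_structure :: "(bool \<Rightarrow> real measure) \<Rightarrow> bool" where
  "info_structure F \<longleftrightarrow>
     space (F False) \<subseteq> {0<..<1} \<and>
     (\<forall>\<omega>. prob_space (F \<omega>) \<and> sets (F \<omega>) = sets (restrict_space borel (space (F False)))) \<and>
     absolutely_continuous (F False) (F True) \<and>
     absolutely_continuous (F True) (F False) \<and>
     (\<forall>E \<in> sets (F False).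
        1/2 * measure (F True) E = 1/2 * (LINT s:E|F True. s) + 1/2 * (LINT s:E|F False. s))"

definition measure_support :: "real measure \<Rightarrow> real set" where
  "measure_support N = {s \<in> space N. \<forall>U. open U \<and> s \<in> U \<longrightarrow> emeasure N (U \<inter> space N) > 0}"

definition info_structures :: "real \<Rightarrow> (bool \<Rightarrow> real measure) set" where
  "info_structures \<delta> =
     {F. info_structure F \<and> (\<forall>\<omega>. measure_support (F \<omega>) \<subseteq> {1/2 - \<delta> .. 1/2 + \<delta>})}"

definition binary_info_structures :: "real \<Rightarrow> (bool \<Rightarrow> real measure) set" where
  "binary_info_structures \<delta> = {F \<in> info_structures \<delta>. \<forall>\<omega>. card (measure_support (F \<omega>)) = 2}"

text \<open>
  Closed form of the update of belief \<open>b\<close> after signal \<open>s\<close>; unlike the log-likelihood form it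
  also covers the degenerate beliefs 0 and 1, which are not moved by any signal.
\<close>

definition update :: "real \<Rightarrow> real \<Rightarrow> real" where
  "update b s = b * s / (b * s + (1 - b) * (1 - s))"

definition lr :: "real \<Rightarrow> real" where
  "lr b = ln (b / (1 - b))"

lemma lr_update:
  assumes "0 < b" "b < 1" "0 < s" "s < 1"
  shows "0 < update b s" "update b s < 1" "lr (update b s) = lr b + lr s"
proof -
  let ?d = "b * s + (1 - b) * (1 - s)"
  have p: "0 < b * s" and q: "0 < (1 - b) * (1 - s)"
    using assms by simp_all
  then have d: "0 < ?d" by linarith
  show "0 < update b s" "update b s < 1"
    unfolding update_def using p q d by simp_all
  have "1 - update b s = (1 - b) * (1 - s) / ?d"
    unfolding update_def using d by (simp add: field_simps)
  then have "update b s / (1 - update b s) = (b / (1 - b)) * (s / (1 - s))"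
    unfolding update_def using d by simp
  then show "lr (update b s) = lr b + lr s"
    unfolding lr_def using assms by (simp only: ln_mult_pos divide_pos_pos diff_gt_0_iff_gt)
qed


section \<open>Cheap-talk equilibria\<close>

definition message_prob :: "real \<Rightarrow> (bool \<Rightarrow> real pmf) \<Rightarrow> real \<Rightarrow> real" where
  "message_prob \<pi> \<sigma> m = (\<Sum>\<omega>\<in>UNIV. weight \<pi> \<omega> * pmf (\<sigma> \<omega>) m)"

definition sender_strategy :: "real \<Rightarrow> real set \<Rightarrow> (bool \<Rightarrow> real pmf) \<Rightarrow> bool" where
  "sender_strategy \<pi> M \<sigma> \<longleftrightarrow>
     finite M \<and> M \<subseteq> {0..1} \<and> (\<forall>\<omega>. set_pmf (\<sigma> \<omega>) \<subseteq> M) \<and>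
     (\<forall>m\<in>M. message_prob \<pi> \<sigma> m > 0 \<longrightarrow> \<pi> * pmf (\<sigma> True) m / message_prob \<pi> \<sigma> m = m)"

definition receiver_strategy ::
    "'a set \<Rightarrow> (bool \<Rightarrow> real measure) \<Rightarrow> real set \<Rightarrow> (real \<Rightarrow> real \<Rightarrow> 'a pmf) \<Rightarrow> bool" where
  "receiver_strategy A F M \<rho> \<longleftrightarrow>
     (\<forall>m\<in>M. \<forall>s\<in>space (F False). set_pmf (\<rho> m s) \<subseteq> A) \<and>
     (\<forall>a\<in>A. (\<lambda>(m, s). pmf (\<rho> m s) a) \<in> borel_measurable (count_space M \<Otimes>\<^sub>M F False))"

definition message_payoff ::
    "('a \<Rightarrow> real) \<Rightarrow> (bool \<Rightarrow> real measure) \<Rightarrow> (real \<Rightarrow> real \<Rightarrow> 'a pmf) \<Rightarrow> bool \<Rightarrow> real \<Rightarrow> real" where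
  "message_payoff uS F \<rho> \<omega> m = (LINT s|F \<omega>. measure_pmf.expectation (\<rho> m s) uS)"

definition cheap_talk_equilibrium ::
    "'a set \<Rightarrow> ('a \<Rightarrow> bool \<Rightarrow> real) \<Rightarrow> ('a \<Rightarrow> real) \<Rightarrow> real \<Rightarrow> (bool \<Rightarrow> real measure) \<Rightarrow>
     real set \<Rightarrow> (bool \<Rightarrow> real pmf) \<Rightarrow> (real \<Rightarrow> real \<Rightarrow> 'a pmf) \<Rightarrow> bool" where
  "cheap_talk_equilibrium A uR uS \<pi> F M \<sigma> \<rho> \<longleftrightarrow>
     sender_strategy \<pi> M \<sigma> \<and> receiver_strategy A F M \<rho> \<and>
     (\<forall>m\<in>M. \<forall>s\<in>space (F False). message_prob \<pi> \<sigma> m > 0 \<longrightarrow>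
        set_pmf (\<rho> m s) \<subseteq> optimal_actions A uR (update m s)) \<and>
     (\<forall>m\<in>M. \<forall>\<omega>. pmf (\<sigma> \<omega>) m > 0 \<longrightarrow>
        (\<forall>m'\<in>M. message_prob \<pi> \<sigma> m' > 0 \<longrightarrow>
           message_payoff uS F \<rho> \<omega> m \<ge> message_payoff uS F \<rho> \<omega> m'))"

definition sender_payoff ::
    "('a \<Rightarrow> real) \<Rightarrow> real \<Rightarrow> (bool \<Rightarrow> real measure) \<Rightarrow>
     real set \<Rightarrow> (bool \<Rightarrow> real pmf) \<Rightarrow> (real \<Rightarrow> real \<Rightarrow> 'a pmf) \<Rightarrow> real" where
  "sender_payoff uS \<pi> F M \<sigma> \<rho> =
     (\<Sum>\<omega>\<in>UNIV. weight \<pi> \<omega> * (\<Sum>m\<in>M. pmf (\<sigma> \<omega>) m * message_payoff uS F \<rho> \<omega> m))"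

definition equilibrium_value ::
    "'a set \<Rightarrow> ('a \<Rightarrow> bool \<Rightarrow> real) \<Rightarrow> ('a \<Rightarrow> real) \<Rightarrow> real \<Rightarrow> (bool \<Rightarrow> real measure) \<Rightarrow> ereal" where
  "equilibrium_value A uR uS \<pi> F =
     (SUP (M, \<sigma>, \<rho>) \<in> {(M, \<sigma>, \<rho>). cheap_talk_equilibrium A uR uS \<pi> F M \<sigma> \<rho>}.
        ereal (sender_payoff uS \<pi> F M \<sigma> \<rho>))"

definition binary_robust_value ::
    "'a set \<Rightarrow> ('a \<Rightarrow> bool \<Rightarrow> real) \<Rightarrow> ('a \<Rightarrow> real) \<Rightarrow> real \<Rightarrow> ereal" where
  "binary_robust_value A uR uS \<pi> =
     Lim (at_right 0) (\<lambda>\<delta>. INF F \<in> binary_info_structures \<delta>. equilibrium_value A uR uS \<pi> F)"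

text \<open>The limit always exists, so \<^const>\<open>Lim\<close> is never applied outside its domain.\<close>

lemma binary_robust_value_tendsto:
  "((\<lambda>\<delta>. INF F \<in> binary_info_structures \<delta>. equilibrium_value A uR uS \<pi> F)
      \<longlongrightarrow> binary_robust_value A uR uS \<pi>) (at_right 0)"
proof -
  define f where "f = (\<lambda>\<delta>. INF F \<in> binary_info_structures \<delta>. equilibrium_value A uR uS \<pi> F)"
  have mono: "f d' \<le> f d" if "d \<le> d'" for d d'
  proof -
    have "{1/2 - d .. 1/2 + d} \<subseteq> {1/2 - d' .. 1/2 + d'}"
      using that by auto
    then have "binary_info_structures d \<subseteq> binary_info_structures d'"
      unfolding binary_info_structures_def info_structures_def by blast
    then show ?thesis
      unfolding f_def by (rule INF_superset_mono) simp
  qed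
  have "(f \<longlongrightarrow> (SUP \<delta>\<in>{0<..}. f \<delta>)) (at_right 0)"
  proof (rule order_tendstoI)
    fix y assume "y < (SUP \<delta>\<in>{0<..}. f \<delta>)"
    then obtain d where d: "d > 0" "y < f d"
      by (auto simp: less_SUP_iff)
    show "eventually (\<lambda>\<delta>. y < f \<delta>) (at_right 0)"
      unfolding eventually_at_right_field
      using d mono by (meson less_le_trans less_imp_le)
  next
    fix y assume y: "(SUP \<delta>\<in>{0<..}. f \<delta>) < y"
    have "f \<delta> < y" if "\<delta> > 0" for \<delta>
      using that y by (intro le_less_trans[OF SUP_upper y]) simp
    then show "eventually (\<lambda>\<delta>. f \<delta> < y) (at_right 0)"
      unfolding eventually_at_right_field by (meson zero_less_one)
  qed
  moreover from this have "Lim (at_right 0) f = (SUP \<delta>\<in>{0<..}. f \<delta>)"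
    by (intro tendsto_Lim) simp_all
  ultimately show ?thesis
    unfolding binary_robust_value_def f_def by simp
qed


section \<open>The game with payoff matrix \<open>B\<close>\<close>

text \<open>Mixed-strategy value (in maxmin form) of a finite zero-sum game with rows \<open>R\<close> and columns \<open>C\<close>.\<close>

definition game_value :: "'r set \<Rightarrow> 'c set \<Rightarrow> ('r \<Rightarrow> 'c \<Rightarrow> real) \<Rightarrow> ereal" where
  "game_value R C B =
     (SUP p \<in> {p. set_pmf p \<subseteq> R}. INF q \<in> {q. set_pmf q \<subseteq> C}.
        ereal (\<Sum>r\<in>R. \<Sum>c\<in>C. pmf p r * pmf q c * B r c))"

definition quad_type1 :: "('a \<Rightarrow> real) \<Rightarrow> 'a \<times> 'a \<times> 'a \<times> 'a \<Rightarrow> bool" where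
  "quad_type1 u = (\<lambda>(ai, ai1, ak, ak1). u ai < u ak \<and> u ak < u ai1 \<and> u ai1 < u ak1)"

definition quad_type2 :: "('a \<Rightarrow> real) \<Rightarrow> 'a \<times> 'a \<times> 'a \<times> 'a \<Rightarrow> bool" where
  "quad_type2 u = (\<lambda>(ai, ai1, ak, ak1). u ak1 < u ai1 \<and> u ai1 < u ak \<and> u ak < u ai)"

definition quad_type3 :: "('a \<Rightarrow> real) \<Rightarrow> 'a \<times> 'a \<times> 'a \<times> 'a \<Rightarrow> bool" where
  "quad_type3 u = (\<lambda>(ai, ai1, ak, ak1). u ak < u ai \<and> u ai < u ak1 \<and> u ak1 < u ai1)"

definition quad_type4 :: "('a \<Rightarrow> real) \<Rightarrow> 'a \<times> 'a \<times> 'a \<times> 'a \<Rightarrow> bool" where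
  "quad_type4 u = (\<lambda>(ai, ai1, ak, ak1). u ai1 < u ak1 \<and> u ak1 < u ai \<and> u ai < u ak)"

definition Q_set :: "(nat \<Rightarrow> 'a) \<Rightarrow> nat \<Rightarrow> ('a \<Rightarrow> real) \<Rightarrow> nat \<Rightarrow> ('a \<times> 'a \<times> 'a \<times> 'a) set" where
  "Q_set act l u j =
     {(act i, act (i + 1), act k, act (k + 1)) | i k.
        1 \<le> i \<and> i + 1 \<le> j \<and> j \<le> k \<and> k + 1 \<le> l \<and> i + 1 < k \<and>
        (let t = (act i, act (i + 1), act k, act (k + 1)) in
           quad_type1 u t \<or> quad_type2 u t \<or> quad_type3 u t \<or> quad_type4 u t)}"

text \<open>
  The rows of \<open>B\<close> are indexed by the elements of \<open>Q\<close> themselves and its columns by 1 and 2.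
  The four types exclude each other, so for rows in \<open>Q\<close> the \<open>else\<close> case is type 3 or 4.
\<close>

definition B_matrix :: "('a \<Rightarrow> real) \<Rightarrow> 'a \<times> 'a \<times> 'a \<times> 'a \<Rightarrow> nat \<Rightarrow> real" where
  "B_matrix u t c =
     (case t of (ai, ai1, ak, ak1) \<Rightarrow>
        if quad_type1 u t \<or> quad_type2 u t
        then (if c = 1 then u ak else u ai1)
        else (if c = 1 then u ai else u ak1))"

definition Val_B :: "(nat \<Rightarrow> 'a) \<Rightarrow> nat \<Rightarrow> ('a \<Rightarrow> real) \<Rightarrow> nat \<Rightarrow> ereal" where
  "Val_B act l u j =
     (if Q_set act l u j = {} then -\<infinity>
      else game_value (Q_set act l u j) {1, 2} (B_matrix u))"


section \<open>The set \<open>T\<close>\<close>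

definition T1_set :: "(nat \<Rightarrow> 'a) \<Rightarrow> nat \<Rightarrow> ('a \<Rightarrow> real) \<Rightarrow> nat \<Rightarrow> ('a \<times> 'a \<times> 'a) set" where
  "T1_set act l u j =
     {(act 1, act i, act (i + 1)) | i.
        1 < i \<and> i < l \<and> 1 < j \<and> j \<le> i \<and> u (act i) < u (act 1) \<and> u (act 1) < u (act (i + 1))}"

definition T2_set :: "(nat \<Rightarrow> 'a) \<Rightarrow> nat \<Rightarrow> ('a \<Rightarrow> real) \<Rightarrow> nat \<Rightarrow> ('a \<times> 'a \<times> 'a) set" where
  "T2_set act l u j =
     {(act (i - 1), act i, act l) | i.
        1 < i \<and> i < l \<and> i \<le> j \<and> j < l \<and> u (act i) < u (act l) \<and> u (act l) < u (act (i - 1))}"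

definition v_first :: "(nat \<Rightarrow> 'a) \<Rightarrow> nat \<Rightarrow> ('a \<Rightarrow> real) \<Rightarrow> nat \<Rightarrow> ereal" where
  "v_first act l u j = (if T1_set act l u j \<noteq> {} then ereal (u (act 1)) else -\<infinity>)"

definition v_last :: "(nat \<Rightarrow> 'a) \<Rightarrow> nat \<Rightarrow> ('a \<Rightarrow> real) \<Rightarrow> nat \<Rightarrow> ereal" where
  "v_last act l u j = (if T2_set act l u j \<noteq> {} then ereal (u (act l)) else -\<infinity>)"

end

theory Submission
  imports Defs
begin

text \<open>
  With two signals, low and high, a message with posterior in \<open>(0, 1)\<close> yields expected payoffs
  \<open>(1 - p \<omega>) y\<^sub>0 + p \<omega> y\<^sub>1\<close> in the two states, where \<open>(y\<^sub>0, y\<^sub>1)\<close> are the sender's payoffs after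
  the low and the high signal.  Since \<open>p\<close> differs between the states, the sender's indifference
  forces all messages in \<open>(0, 1)\<close> to induce the same pair.  Signals close to 1/2 leave
  only the constant pair of \<open>a\<^sub>j\<close> or a common point of two L-shaped paths, one for a cutoff on
  each side of the prior; by genericity, such points are exactly the rows of \<open>B\<close>.
  A message with posterior 0 (or 1) pins the payoff in state 0 (or 1) to that of \<open>a\<^sub>1\<close> (or
  \<open>a\<^sub>\<ell>\<close>), and the payoff in the other state is close to it when \<open>p\<close> hardly depends on the state.
  For given \<open>F\<close> the sender picks the best row against the column mixture given by the signal
  distribution; nature chooses this mixture, which gives the value of \<open>B\<close> by the minimax theorem.
\<close>


text \<open>The upper bound needs only two messages of an arbitrary equilibrium. Messages sent in a
  state are equally good there, and posteriors average to the prior, so one sent message at or below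
  the prior and one at or above it determine the payoff. If the lower one is 0, it is not sent in
  state 1: the other message matches its payoff \<open>u 1\<close> exactly in state 0, but is only
  bounded below by it in state 1. A non-constant pair must then increase strictly across
  \<open>u 1\<close>, and this is the order in a triple of type 1 in \<open>T\<close>; type 2 is the
  mirror image. The gain in the unpinned state is at most \<open>(p True - p False) * C\<close>.
  This excess, together with the fact that the high-signal probability only approximates nature's
  optimal mixture, is why the upper bound carries an error that vanishes in the limit, while the
  lower bound holds without error for every structure once \<delta> is small.\<close>

section \<open>The value of a game with two columns\<close>

text \<open>Nature aims for \<open>q\<close> in the upper bound, and the last clause hands the
  sender a good row against whatever mixture the signals produce. The last clause is the easy half,
  since against a known mixture some pure row is a best reply; the existence of \<open>q\<close> is
  the minimax theorem and rests on convexity.\<close>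

lemma game_value_two_columns:
  fixes B :: "'r \<Rightarrow> nat \<Rightarrow> real"
  assumes "finite R" "R \<noteq> {}"
  shows "\<exists>v q. game_value R {1, 2} B = ereal v \<and> 0 \<le> q \<and> q \<le> 1 \<and>
           (\<forall>r\<in>R. (1 - q) * B r 1 + q * B r 2 \<le> v) \<and>
           (\<forall>t. 0 \<le> t \<longrightarrow> t \<le> 1 \<longrightarrow> (\<exists>r\<in>R. v \<le> (1 - t) * B r 1 + t * B r 2))"
proof -
  define g where "g p c = (\<Sum>r\<in>R. pmf p r * B r c)" for p c
  define V where "V = game_value R {1, 2} B"
  have inner: "(\<Sum>r\<in>R. \<Sum>c\<in>{1, 2}. pmf p r * pmf q c * B r c) = pmf q 1 * g p 1 + pmf q 2 * g p 2" for p and q :: "nat pmf"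
    by (simp add: g_def sum.distrib sum_distrib_left algebra_simps)
  have V_eq: "V = (SUP p \<in> {p. set_pmf p \<subseteq> R}. INF q \<in> {q. set_pmf q \<subseteq> {1, 2}}.
        ereal (pmf q 1 * g p 1 + pmf q (2::nat) * g p 2))"
    unfolding V_def game_value_def inner ..
  have sum_R: "(\<Sum>r\<in>R. pmf p r) = 1" if "set_pmf p \<subseteq> R" for p
    using assms that by (intro sum_pmf_eq_1) auto
  have sum_q: "pmf q 1 + pmf q 2 = 1" if "set_pmf q \<subseteq> {1, 2::nat}" for q
    using sum_pmf_eq_1[of "{1, 2}" q] that by auto
  have lower: "ereal (min (g p 1) (g p 2)) \<le> V" if p: "set_pmf p \<subseteq> R" for p
  proof -
    have "min (g p 1) (g p 2) \<le> pmf q 1 * g p 1 + pmf q 2 * g p 2" if q: "set_pmf q \<subseteq> {1, 2::nat}" for q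
    proof -
      have "pmf q 1 * min (g p 1) (g p 2) + pmf q 2 * min (g p 1) (g p 2)
            \<le> pmf q 1 * g p 1 + pmf q 2 * g p 2"
        by (intro add_mono mult_left_mono) auto
      then show ?thesis
        using sum_q[OF q] by (simp flip: distrib_right)
    qed
    then show ?thesis
      unfolding V_eq using p by (intro SUP_upper2[of p] INF_greatest) (auto simp del: One_nat_def simp flip: ereal_min)
  qed
  have upper: "\<exists>r\<in>R. V \<le> ereal ((1 - t) * B r 1 + t * B r 2)" if t: "0 \<le> t" "t \<le> 1" for t
  proof -
    define q where "q = map_pmf (\<lambda>b. if b then 2 else 1::nat) (bernoulli_pmf t)"
    define h where "h r = (1 - t) * B r 1 + t * B r 2" for r
    have q: "set_pmf q \<subseteq> {1, 2}"
      by (auto simp: q_def split: if_splits)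
    have "pmf q (2::nat) = t"
    proof -
      have "pmf q 2 = measure (bernoulli_pmf t) ((\<lambda>b. if b then 2 else 1::nat) -` {2})"
        by (simp add: q_def pmf_map)
      also have "(\<lambda>b. if b then 2 else 1::nat) -` {2} = {True}"
        by (auto split: if_splits)
      finally show ?thesis
        using t by (simp add: measure_pmf_single)
    qed
    with sum_q[OF q] have pq: "pmf q 2 = t" "pmf q 1 = 1 - t" by auto
    have "V \<le> ereal (Max (h ` R))"
      unfolding V_eq
    proof (intro SUP_least)
      fix p assume "p \<in> {p. set_pmf p \<subseteq> R}"
      then have p: "set_pmf p \<subseteq> R" by simp
      have "(1 - t) * g p 1 + t * g p 2 = (\<Sum>r\<in>R. pmf p r * h r)"
        by (simp add: g_def h_def sum_distrib_left algebra_simps flip: sum.distrib)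
      also have "\<dots> \<le> (\<Sum>r\<in>R. pmf p r * Max (h ` R))"
        using assms by (intro sum_mono mult_left_mono) auto
      also have "\<dots> = Max (h ` R)"
        using sum_R[OF p] by (simp flip: sum_distrib_right)
      finally show "(INF q \<in> {q. set_pmf q \<subseteq> {1, 2}}. ereal (pmf q 1 * g p 1 + pmf q (2::nat) * g p 2))
          \<le> ereal (Max (h ` R))"
        using q pq by (intro INF_lower2[of q]) auto
    qed
    moreover have "Max (h ` R) \<in> h ` R"
      using assms by (intro Max_in) auto
    ultimately show ?thesis
      unfolding h_def by auto
  qed
  obtain v where v: "V = ereal v"
  proof -
    obtain r where r: "r \<in> R" using assms by auto
    have "V \<noteq> -\<infinity>"
      using lower[of "return_pmf r"] r by (auto simp flip: ereal_min)
    moreover have "V \<noteq> \<infinity>"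
      using upper[of 0] by auto
    ultimately show ?thesis using that by (cases V) auto
  qed
  \<comment> \<open>Minimax: separate the achievable payoff pairs from those exceeding \<open>v\<close> in both columns.\<close>
  define C where "C = (\<lambda>p. (g p 1, g p 2)) ` {p. set_pmf p \<subseteq> R}"
  define D where "D = {v<..} \<times> {v<..}"
  have "convex C"
  proof (rule convexI)
    fix y z and a b :: real
    assume "y \<in> C" "z \<in> C" and ab: "0 \<le> a" "0 \<le> b" "a + b = 1"
    then obtain p p' where p: "set_pmf p \<subseteq> R" "set_pmf p' \<subseteq> R"
      and yz: "y = (g p 1, g p 2)" "z = (g p' 1, g p' 2)"
      by (auto simp: C_def)
    define p2 where "p2 = bind_pmf (bernoulli_pmf a) (\<lambda>b. if b then p else p')"
    have "pmf p2 r = a * pmf p r + b * pmf p' r" for r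
      using ab by (simp add: p2_def pmf_bind eq_diff_eq[THEN iffD2])
    then have "g p2 c = a * g p c + b * g p' c" for c
      by (simp add: g_def sum.distrib sum_distrib_left algebra_simps)
    moreover have "set_pmf p2 \<subseteq> R"
      using p by (auto simp: p2_def split: if_splits)
    ultimately show "a *\<^sub>R y + b *\<^sub>R z \<in> C"
      unfolding C_def yz by (auto intro!: image_eqI[of _ _ p2])
  qed
  moreover have "convex D"
    unfolding D_def by (intro convex_Times convex_real_interval)
  moreover have "C \<noteq> {}"
  proof -
    obtain r where "r \<in> R" using assms by auto
    then show ?thesis by (auto simp: C_def intro!: exI[of _ "return_pmf r"])
  qed
  moreover have "D \<noteq> {}"
    by (auto simp: D_def)
  moreover have "C \<inter> D = {}"
  proof -
    have "g p 1 \<le> v \<or> g p 2 \<le> v" if "set_pmf p \<subseteq> R" for p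
      using lower[OF that] by (simp only: v ereal_less_eq min_le_iff_disj)
    then show ?thesis unfolding C_def D_def by (force simp del: One_nat_def)
  qed
  ultimately obtain a b where ab: "a \<noteq> 0" "\<And>y. y \<in> C \<Longrightarrow> inner a y \<le> b" "\<And>y. y \<in> D \<Longrightarrow> inner a y \<ge> b"
    using separating_hyperplane_sets[of C D] by blast
  obtain a1 a2 where a: "a = (a1, a2)" by (cases a)
  have D': "b \<le> a1 * (v + d) + a2 * (v + e)" if "d > 0" "e > 0" for d e
    using ab(3)[of "(v + d, v + e)"] that by (simp add: a D_def)
  have "a1 \<ge> 0"
  proof (rule ccontr)
    assume neg: "\<not> a1 \<ge> 0"
    \<comment> \<open>With a negative \<open>a1\<close>, moving far out in the first coordinate of
      \<open>D\<close> drives the inner product below \<open>b\<close>; this \<open>d\<close> is far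
      enough.\<close>
    define d where "d = (\<bar>a1 * v + a2 * (v + 1) - b\<bar> + 1) / (- a1)"
    have "d > 0" unfolding d_def using neg by (intro divide_pos_pos) auto
    moreover have "a1 * d = - (\<bar>a1 * v + a2 * (v + 1) - b\<bar> + 1)"
      using neg by (simp add: d_def)
    ultimately show False
      using D'[of d 1] by (simp add: algebra_simps)
  qed
  moreover have "a2 \<ge> 0"
  proof (rule ccontr)
    assume neg: "\<not> a2 \<ge> 0"
    define d where "d = (\<bar>a1 * (v + 1) + a2 * v - b\<bar> + 1) / (- a2)"
    have "d > 0" unfolding d_def using neg by (intro divide_pos_pos) auto
    moreover have "a2 * d = - (\<bar>a1 * (v + 1) + a2 * v - b\<bar> + 1)"
      using neg by (simp add: d_def)
    ultimately show False
      using D'[of 1 d] by (simp add: algebra_simps)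
  qed
  ultimately have pos: "a1 + a2 > 0" "a1 \<ge> 0" "a2 \<ge> 0"
    using ab(1) a by (auto simp: zero_prod_def)
  \<comment> \<open>The corner \<open>(v, v)\<close> lies outside the open quadrant
    \<open>D\<close>, so its bound is obtained by approaching it along the diagonal.\<close>
  have b_le: "b \<le> (a1 + a2) * v"
  proof (rule field_le_epsilon)
    fix e :: real assume "e > 0"
    then have "b \<le> a1 * (v + e / (a1 + a2)) + a2 * (v + e / (a1 + a2))"
      using pos by (intro D') auto
    also have "\<dots> = (a1 + a2) * (v + e / (a1 + a2))"
      by (simp only: distrib_right)
    also have "\<dots> = (a1 + a2) * v + e"
      using pos by (simp add: distrib_left del: distrib_right_numeral)
    finally show "b \<le> (a1 + a2) * v + e" .
  qed
  \<comment> \<open>The normal vector of the separating hyperplane, scaled to total weight 1, is the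
    mixture over the columns.\<close>
  define q where "q = a2 / (a1 + a2)"
  have q1: "1 - q = a1 / (a1 + a2)"
    using pos by (simp add: q_def field_simps)
  have "(1 - q) * B r 1 + q * B r 2 \<le> v" if r: "r \<in> R" for r
  proof -
    have "g (return_pmf r) c = B r c" for c
      using r assms by (simp add: g_def indicator_def if_distrib[of "\<lambda>x. x * _"] cong: if_cong)
    then have "(B r 1, B r 2) \<in> C"
      unfolding C_def using r by (auto intro!: image_eqI[of _ _ "return_pmf r"])
    from ab(2)[OF this] b_le have "a1 * B r 1 + a2 * B r 2 \<le> (a1 + a2) * v"
      by (simp add: a)
    moreover have "(1 - q) * B r 1 + q * B r 2 = (a1 * B r 1 + a2 * B r 2) / (a1 + a2)"
      unfolding q1 by (simp add: q_def add_divide_distrib)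
    ultimately show ?thesis
      using pos by (simp add: pos_divide_le_eq mult.commute)
  qed
  moreover have "0 \<le> q" "q \<le> 1"
    using pos by (auto simp: q_def field_simps)
  ultimately show ?thesis
    using upper v unfolding V_def by (intro exI[of _ v] exI[of _ q]) auto
qed

section \<open>Belief updates\<close>

text \<open>The displacement is exactly \<open>b * (1 - b) * (2 * s - 1) / D\<close>. The condition
  \<open>d \<le> 1/4\<close> keeps \<open>s\<close> and \<open>1 - s\<close> at least 1/4, hence
  also their average \<open>D\<close>, which compensates
  \<open>b * (1 - b) \<le> 1/4\<close>.\<close>

lemma abs_update_diff_le:
  assumes "0 \<le> b" "b \<le> 1" "1/2 - d \<le> s" "s \<le> 1/2 + d" "d \<le> 1/4"
  shows "\<bar>update b s - b\<bar> \<le> 2 * d"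
proof -
  define D where "D = b * s + (1 - b) * (1 - s)"
  have "b * (1/4) + (1 - b) * (1/4) \<le> D"
    unfolding D_def using assms by (intro add_mono mult_left_mono) auto
  then have D: "1/4 \<le> D" by (simp add: field_simps)
  have "update b s - b = b * (1 - b) * (2 * s - 1) / D"
    using D unfolding update_def D_def[symmetric] by (simp add: field_simps) (simp add: D_def algebra_simps)
  then have "\<bar>update b s - b\<bar> = b * (1 - b) * \<bar>2 * s - 1\<bar> / D"
    using assms D by (simp add: abs_mult)
  also have "\<dots> \<le> (1/4) * (2 * d) / (1/4)"
  proof (intro frac_le mult_mono D)
    have "0 \<le> (b - 1/2)\<^sup>2" by simp
    then show "b * (1 - b) \<le> 1/4" by (simp add: power2_eq_square algebra_simps)
    show "\<bar>2 * s - 1\<bar> \<le> 2 * d" using assms by (auto simp: abs_le_iff)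
  qed (use assms in auto)
  finally show ?thesis by simp
qed

lemma update_denominator_pos:
  fixes b s :: real
  assumes "0 \<le> b" "b \<le> 1" "0 < s" "s < 1"
  shows "0 < b * s + (1 - b) * (1 - s)"
proof (cases "b = 0")
  case False
  with assms have "0 < b" by linarith
  then have "0 < b * s" using assms by simp
  moreover have "0 \<le> (1 - b) * (1 - s)" using assms by simp
  ultimately show ?thesis by linarith
qed (use assms in simp)

lemma update_in_Icc:
  assumes "0 \<le> b" "b \<le> 1" "0 < s" "s < 1"
  shows "update b s \<in> {0..1}"
proof -
  have "0 \<le> b * s" "0 \<le> (1 - b) * (1 - s)"
    using assms by auto
  then show ?thesis
    using update_denominator_pos[OF assms] by (simp add: update_def)
qed

lemma less_update:
  assumes "0 < b" "b < 1" "1/2 < s" "s < 1"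
  shows "b < update b s"
proof -
  have "0 < b * (1 - b) * (2 * s - 1)" using assms by simp
  then show ?thesis
    unfolding update_def using update_denominator_pos[of b s] assms
    by (simp add: pos_less_divide_eq algebra_simps)
qed

lemma update_less:
  assumes "0 < b" "b < 1" "0 < s" "s < 1/2"
  shows "update b s < b"
proof -
  have "0 < b * (1 - b) * (1 - 2 * s)" using assms by simp
  then show ?thesis
    unfolding update_def using update_denominator_pos[of b s] assms
    by (simp add: pos_divide_less_eq algebra_simps)
qed

text \<open>In log-odds, signal \<open>s\<close> adds \<open>lr s\<close> and signal
  \<open>1 - s\<close> adds \<open>- lr s\<close>, so the two shifts cancel.\<close>

lemma update_complement:
  assumes "0 < b" "b < 1" "0 < s" "s < 1"
  shows "update (update b (1 - s)) s = b"
proof -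
  define D where "D = b * (1 - s) + (1 - b) * s"
  have D: "D > 0" using update_denominator_pos[of b "1 - s"] assms by (simp add: D_def)
  have u: "update b (1 - s) = b * (1 - s) / D" "1 - update b (1 - s) = (1 - b) * s / D"
    using D by (simp_all add: update_def D_def field_simps)
  have "update b (1 - s) * s = b * (s * (1 - s) / D)"
    by (simp add: u(1) mult_ac)
  moreover have "update b (1 - s) * s + (1 - update b (1 - s)) * (1 - s) = s * (1 - s) / D"
    unfolding u(2) unfolding u(1) by (simp add: algebra_simps flip: add_divide_distrib)
  moreover have "s * (1 - s) / D \<noteq> 0"
    using D assms by simp
  ultimately show ?thesis
    by (metis nonzero_mult_div_cancel_right update_def)
qed

lemma update_0 [simp]: "update 0 s = 0"
  by (simp add: update_def)

lemma update_1 [simp]: "0 < s \<Longrightarrow> update 1 s = 1"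
  by (simp add: update_def)

section \<open>Binary information structures\<close>

lemma singleton_in_restrict_space:
  fixes t :: real
  assumes "t \<in> S"
  shows "{t} \<in> sets (restrict_space borel S)"
  unfolding sets_restrict_space using assms by (intro image_eqI[of _ _ "{t}"]) auto

text \<open>Outside the support every point has an open neighbourhood of measure 0, and by Lindelof
  countably many of these cover the complement.\<close>

lemma AE_measure_support:
  assumes "sets N = sets (restrict_space borel (space N))"
  shows "AE s in N. s \<in> measure_support N"
proof -
  define U where "U = {V. open V \<and> emeasure N (V \<inter> space N) = 0}"
  obtain U' where U': "U' \<subseteq> U" "countable U'" "\<Union>U' = \<Union>U"
    by (rule Lindelof[of U]) (auto simp: U_def)
  have "V \<inter> space N \<in> null_sets N" if "V \<in> U'" for V
  proof (rule null_setsI)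
    show "emeasure N (V \<inter> space N) = 0" using that U' by (auto simp: U_def)
    have "V \<in> sets borel" using that U' by (auto simp: U_def)
    then show "V \<inter> space N \<in> sets N"
      unfolding assms sets_restrict_space by (intro image_eqI[of _ _ V]) auto
  qed
  then have "(\<Union>V\<in>U'. V \<inter> space N) \<in> null_sets N"
    using U' by (intro null_sets_UN') auto
  moreover have "(\<Union>V\<in>U'. V \<inter> space N) = \<Union>U \<inter> space N"
    using U' by auto
  ultimately have "\<Union>U \<inter> space N \<in> null_sets N" by simp
  then have "AE s in N. s \<notin> \<Union>U \<inter> space N" by (rule AE_not_in)
  then show ?thesis
  proof (rule AE_mp, intro AE_I2 impI)
    fix s assume "s \<in> space N" "s \<notin> \<Union>U \<inter> space N"
    then show "s \<in> measure_support N"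
      by (auto simp: measure_support_def U_def zero_less_iff_neq_zero)
  qed
qed

text \<open>The form in which binary structures are used: two atoms, the high one more likely in
  state 1. The signal space may contain further points of probability 0, at which the receiver must
  still respond; hence the almost-everywhere condition. Calibration is left behind in the two order
  assumptions.\<close>

locale binary_signals =
  fixes F :: "bool \<Rightarrow> real measure" and s0 s1 :: real and p :: "bool \<Rightarrow> real"
  assumes space_F_subset: "space (F False) \<subseteq> {0<..<1}"
    and sets_F: "\<And>\<omega>. sets (F \<omega>) = sets (restrict_space borel (space (F False)))"
    and prob_space_F: "\<And>\<omega>. prob_space (F \<omega>)"
    and signals_in_space: "s0 \<in> space (F False)" "s1 \<in> space (F False)"
    and AE_signals: "\<And>\<omega>. AE s in F \<omega>. s = s0 \<or> s = s1"
    and measure_s0: "\<And>\<omega>. measure (F \<omega>) {s0} = 1 - p \<omega>"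
    and measure_s1: "\<And>\<omega>. measure (F \<omega>) {s1} = p \<omega>"
    and signal_order: "s0 < 1/2" "1/2 < s1"
    and prob_order: "0 < p False" "p False < p True" "p True < 1"
begin

lemma space_F: "space (F \<omega>) = space (F False)"
  by (rule sets_eq_imp_space_eq) (simp add: sets_F[of \<omega>] sets_F[of False])

lemma signal_bounds: "0 < s0" "s0 < 1" "0 < s1" "s1 < 1"
  using space_F_subset signals_in_space by auto

lemma prob_bounds: "0 < p \<omega>" "p \<omega> < 1"
  using prob_order by (cases \<omega>; simp)+

lemma integral_F:
  fixes f :: "real \<Rightarrow> real"
  assumes [measurable]: "f \<in> borel_measurable (F \<omega>)"
  shows "(LINT s|F \<omega>. f s) = (1 - p \<omega>) * f s0 + p \<omega> * f s1"
proof -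
  interpret prob_space "F \<omega>" by (rule prob_space_F)
  have single: "{s} \<in> sets (F \<omega>)" if "s \<in> space (F False)" for s
    unfolding sets_F[of \<omega>] using that by (rule singleton_in_restrict_space)
  note [measurable] = single[OF signals_in_space(1)] single[OF signals_in_space(2)]
  have "(LINT s|F \<omega>. f s) = (LINT s|F \<omega>. f s0 * indicator {s0} s + f s1 * indicator {s1} s)"
  proof (rule integral_cong_AE)
    show "AE s in F \<omega>. f s = f s0 * indicator {s0} s + f s1 * indicator {s1} s"
      using AE_signals[of \<omega>] by (rule AE_mp) (use signal_order in \<open>auto intro!: AE_I2\<close>)
  qed measurable
  also have "\<dots> = (LINT s|F \<omega>. f s0 * indicator {s0} s) + (LINT s|F \<omega>. f s1 * indicator {s1} s)"
    by (intro Bochner_Integration.integral_add integrable_mult_right integrable_real_indicator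
        single signals_in_space) (simp_all add: emeasure_eq_measure)
  also have "\<dots> = f s0 * measure (F \<omega>) {s0} + f s1 * measure (F \<omega>) {s1}"
    using signals_in_space by (simp add: space_F[of \<omega>])
  finally show ?thesis
    by (simp add: measure_s0 measure_s1 algebra_simps)
qed

end

text \<open>Calibration at an atom \<open>t\<close> makes \<open>t / (1 - t)\<close> the likelihood
  ratio of state 1 against state 0. Both distributions have mass 1 and the two signals differ, so
  one ratio exceeds 1 and the other is below 1. Thus the signals straddle 1/2, and the larger one is
  more likely in state 1.\<close>

lemma binary_signals_exists:
  assumes F: "F \<in> binary_info_structures \<delta>"
  shows "\<exists>s0 s1 p. binary_signals F s0 s1 p \<and> 1/2 - \<delta> \<le> s0 \<and> s1 \<le> 1/2 + \<delta>"
proof -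
  have sub: "space (F False) \<subseteq> {0<..<1}"
    and prob: "\<And>\<omega>. prob_space (F \<omega>)"
    and sets: "\<And>\<omega>. sets (F \<omega>) = sets (restrict_space borel (space (F False)))"
    and ac: "absolutely_continuous (F False) (F True)" "absolutely_continuous (F True) (F False)"
    and calib: "\<And>E. E \<in> sets (F False) \<Longrightarrow>
        1/2 * measure (F True) E = 1/2 * (LINT s:E|F True. s) + 1/2 * (LINT s:E|F False. s)"
    and supp: "\<And>\<omega>. measure_support (F \<omega>) \<subseteq> {1/2 - \<delta> .. 1/2 + \<delta>}"
    and card: "\<And>\<omega>. card (measure_support (F \<omega>)) = 2"
    using F unfolding binary_info_structures_def info_structures_def info_structure_def by blast+
  have space: "space (F \<omega>) = space (F False)" for \<omega>
    by (rule sets_eq_imp_space_eq) (simp add: sets[of \<omega>] sets[of False])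
  obtain a b where ab: "measure_support (F False) = {a, b}" "a \<noteq> b"
    using card[of False] by (auto simp: card_2_iff)
  define s0 s1 where "s0 = min a b" and "s1 = max a b"
  have s: "measure_support (F False) = {s0, s1}" "s0 < s1"
    using ab by (auto simp: s0_def s1_def min_def max_def)
  then have in_space: "s0 \<in> space (F False)" "s1 \<in> space (F False)"
    by (auto simp: measure_support_def)
  have single: "{t} \<in> sets (F \<omega>)" if "t \<in> space (F False)" for t \<omega>
    unfolding sets[of \<omega>] using that by (rule singleton_in_restrict_space)
  have AE_low_state: "AE t in F False. t = s0 \<or> t = s1"
    using AE_measure_support[OF sets[of False]] by (simp add: s)
  have null: "space (F False) - {s0, s1} \<in> null_sets (F False)"
  proof -
    have "{s0, s1} \<in> sets (F False)"
      using sets.Un[OF single[OF in_space(1)] single[OF in_space(2)]] by (simp add: insert_commute)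
    then have "space (F False) - {s0, s1} \<in> sets (F False)" by auto
    then show ?thesis
      by (subst AE_iff_null_sets) (use AE_low_state in auto)
  qed
  have AE_high_state: "AE t in F True. t = s0 \<or> t = s1"
  proof -
    have "space (F False) - {s0, s1} \<in> null_sets (F True)"
      using null ac(1) by (auto simp: absolutely_continuous_def)
    from AE_not_in[OF this] show ?thesis
      by (rule AE_mp) (rule AE_I2, auto simp: space[of True])
  qed
  have AE: "AE t in F \<omega>. t = s0 \<or> t = s1" for \<omega>
    by (induction \<omega>) (fact AE_high_state AE_low_state)+
  have pos: "measure (F \<omega>) {t} > 0" if t: "t = s0 \<or> t = s1" for t \<omega>
  proof -
    interpret prob_space "F \<omega>" by (rule prob)
    have tS: "t \<in> space (F False)" using t in_space by auto
    \<comment> \<open>An open neighbourhood of \<open>t\<close> that misses the other atom; up to a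
      null set its mass is that of \<open>t\<close> alone.\<close>
    define U where "U = - ({s0, s1} - {t})"
    have "open U" unfolding U_def by (intro open_Compl finite_imp_closed) auto
    moreover have "t \<in> U" by (simp add: U_def)
    moreover have "\<forall>U. open U \<and> t \<in> U \<longrightarrow> emeasure (F False) (U \<inter> space (F False)) > 0"
    proof -
      have "t \<in> measure_support (F False)" using t s by auto
      then show ?thesis by (simp add: measure_support_def)
    qed
    ultimately have "emeasure (F False) (U \<inter> space (F False)) > 0"
      by blast
    moreover have "emeasure (F False) (U \<inter> space (F False)) = emeasure (F False) {t}"
    proof (rule emeasure_eq_AE)
      show "AE x in F False. (x \<in> U \<inter> space (F False)) = (x \<in> {t})"
        using t tS by (rule_tac AE_mp[OF AE_low_state], rule_tac AE_I2) (auto simp: U_def)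
      show "U \<inter> space (F False) \<in> sets (F False)"
        unfolding sets[of False] sets_restrict_space using \<open>open U\<close> by (intro image_eqI[of _ _ U]) auto
    qed (rule single[OF tS])
    ultimately have "{t} \<notin> null_sets (F False)" by auto
    then have "{t} \<notin> null_sets (F \<omega>)"
      using ac(2) by (cases \<omega>) (auto simp: absolutely_continuous_def)
    then have "emeasure (F \<omega>) {t} \<noteq> 0"
      using single[OF tS, of \<omega>] by (auto simp: null_sets_def)
    then show ?thesis
      by (simp add: emeasure_eq_measure zero_less_measure_iff)
  qed
  have ratio: "measure (F True) {t} * (1 - t) = t * measure (F False) {t}" if t: "t = s0 \<or> t = s1" for t
  proof -
    have tS: "t \<in> space (F False)" using t in_space by auto
    have lint: "(LINT s:{t}|F \<omega>. s) = t * measure (F \<omega>) {t}" for \<omega>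
    proof -
      interpret prob_space "F \<omega>" by (rule prob)
      have "(LINT s:{t}|F \<omega>. s) = (LINT s|F \<omega>. t * indicator {t} s)"
        unfolding set_lebesgue_integral_def
        by (intro Bochner_Integration.integral_cong) (auto simp: indicator_def)
      also have "\<dots> = t * measure (F \<omega>) {t}"
        using tS space[of \<omega>] by simp
      finally show ?thesis .
    qed
    show ?thesis
      using calib[OF single[OF tS]] unfolding lint by (simp add: algebra_simps)
  qed
  have sum1: "measure (F \<omega>) {s0} + measure (F \<omega>) {s1} = 1" for \<omega>
  proof -
    interpret prob_space "F \<omega>" by (rule prob)
    have "{s0} \<union> {s1} \<in> events" by (intro sets.Un single in_space)
    moreover have "AE x in F \<omega>. x \<in> {s0} \<union> {s1}" using AE[of \<omega>] by (simp add: disj_commute)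
    ultimately have "prob ({s0} \<union> {s1}) = 1" by (simp only: prob_eq_1)
    moreover have "prob ({s0} \<union> {s1}) = prob {s0} + prob {s1}"
      using s by (intro finite_measure_Union single in_space) auto
    ultimately show ?thesis by simp
  qed
  define p where "p \<omega> = measure (F \<omega>) {s1}" for \<omega>
  have p0: "measure (F \<omega>) {s0} = 1 - p \<omega>" for \<omega>
    using sum1[of \<omega>] by (simp add: p_def)
  have pp: "0 < p \<omega>" "p \<omega> < 1" for \<omega>
    using pos[of s1 \<omega>] pos[of s0 \<omega>] by (simp_all add: p0) (simp add: p_def)
  have r1: "p True * (1 - s1) = s1 * p False"
    using ratio[of s1] by (simp add: p_def)
  have r0: "(1 - p True) * (1 - s0) = s0 * (1 - p False)"
    using ratio[of s0] by (simp add: p0)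
  have sb: "0 < s0" "s0 < 1" "0 < s1" "s1 < 1" using sub in_space by auto
  have s1_eq: "s1 * (p True + p False) = p True" using r1 by (simp add: algebra_simps)
  have s0_eq: "s0 * ((1 - p True) + (1 - p False)) = 1 - p True" using r0 by (simp add: algebra_simps)
  have "p False < p True"
  proof (rule ccontr)
    assume neg: "\<not> p False < p True"
    have "s1 \<le> 1/2"
    proof -
      have "s1 * (p True + p False) \<le> (1/2) * (p True + p False)"
        using s1_eq neg by simp
      then show ?thesis using pp[of True] pp[of False] by (simp add: mult_le_cancel_right)
    qed
    moreover have "1/2 \<le> s0"
    proof -
      have "(1/2) * ((1 - p True) + (1 - p False)) \<le> s0 * ((1 - p True) + (1 - p False))"
        using s0_eq neg by simp
      then show ?thesis using pp[of True] pp[of False] by (simp add: mult_le_cancel_right)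
    qed
    ultimately show False using s(2) by simp
  qed
  moreover have "s0 < 1/2"
  proof -
    have "s0 * ((1 - p True) + (1 - p False)) < (1/2) * ((1 - p True) + (1 - p False))"
      using s0_eq calculation by simp
    then show ?thesis using pp[of True] pp[of False] by (simp add: mult_less_cancel_right)
  qed
  moreover have "1/2 < s1"
  proof -
    have "(1/2) * (p True + p False) < s1 * (p True + p False)"
      using s1_eq calculation by simp
    then show ?thesis using pp[of True] pp[of False] by (simp add: mult_less_cancel_right)
  qed
  ultimately have "binary_signals F s0 s1 p"
    using sub prob in_space AE p0 pp sets
    by (intro binary_signals.intro) (simp_all add: p_def)
  moreover have "1/2 - \<delta> \<le> s0" "s1 \<le> 1/2 + \<delta>"
    using supp[of False] by (auto simp: s)
  ultimately show ?thesis by blast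
qed

text \<open>The formulas for \<open>s0\<close> and \<open>s1\<close> are Bayes' rule with prior 1/2:
  the share of state 1 in the total probability of the low and of the high signal. So nature may
  choose \<open>p\<close> freely, as long as the resulting signals are within \<delta> of
  1/2.\<close>

lemma binary_info_structure_exists:
  fixes p :: "bool \<Rightarrow> real"
  assumes p: "0 < p False" "p False < p True" "p True < 1"
    and s0_eq: "s0 = (1 - p True) / (2 - p True - p False)" and s1_eq: "s1 = p True / (p True + p False)"
    and d: "1/2 - \<delta> \<le> s0" "s1 \<le> 1/2 + \<delta>"
  shows "\<exists>F \<in> binary_info_structures \<delta>. binary_signals F s0 s1 p"
proof -
  define c where "c b = (if b then s1 else s0)" for b
  define X where "X = restrict_space borel {0<..<1::real}"
  define F where "F \<omega> = distr (measure_pmf (bernoulli_pmf (p \<omega>))) X c" for \<omega>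
  have pb: "0 < p \<omega>" "p \<omega> < 1" for \<omega> using p by (cases \<omega>; simp)+
  have s: "0 < s0" "s0 < 1/2" "1/2 < s1" "s1 < 1"
    using p unfolding s0_eq s1_eq by (simp_all add: field_simps)
  have c: "c \<in> measurable (measure_pmf q) X" for q
    using s by (auto simp: X_def c_def measurable_restrict_space2_iff space_restrict_space)
  have space: "space (F \<omega>) = {0<..<1}" for \<omega>
    by (simp add: F_def X_def space_restrict_space)
  have sets: "sets (F \<omega>) = sets (restrict_space borel {0<..<1})" for \<omega>
    by (simp add: F_def X_def)
  have prob: "prob_space (F \<omega>)" for \<omega>
    unfolding F_def by (intro prob_space.prob_space_distr c prob_space_measure_pmf)
  have integral: "(LINT s|F \<omega>. f s) = (1 - p \<omega>) * f s0 + p \<omega> * f s1" if "f \<in> borel_measurable X" for f :: "real \<Rightarrow> real" and \<omega>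
    unfolding F_def using that pb[of \<omega>] by (subst integral_distr[OF c]) (auto simp: c_def)
  have meas: "measure (F \<omega>) E = (1 - p \<omega>) * indicator E s0 + p \<omega> * indicator E s1" if "E \<in> sets X" for E \<omega>
  proof -
    interpret prob_space "F \<omega>" by (rule prob)
    have E: "E \<in> events" using that by (simp add: F_def)
    then have "measure (F \<omega>) E = (LINT s|F \<omega>. indicator E s)"
      using sets.sets_into_space[OF E] by (simp add: Int_absorb2)
    then show ?thesis
      using that by (subst (asm) integral) auto
  qed
  have single: "{t} \<in> sets X" if "0 < t" "t < 1" for t
    unfolding X_def using that by (intro singleton_in_restrict_space) auto
  have emeas: "emeasure (F \<omega>) E = ennreal ((1 - p \<omega>) * indicator E s0 + p \<omega> * indicator E s1)" if "E \<in> sets X" for E \<omega>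
  proof -
    interpret prob_space "F \<omega>" by (rule prob)
    show ?thesis using meas[OF that] by (simp add: emeasure_eq_measure)
  qed
  have emeas_0: "emeasure (F \<omega>) E = 0 \<longleftrightarrow> s0 \<notin> E \<and> s1 \<notin> E" if "E \<in> sets X" for E \<omega>
    using pb[of \<omega>] unfolding emeas[OF that] by (auto simp: indicator_def ennreal_eq_0_iff)
  have supp: "measure_support (F \<omega>) = {s0, s1}" for \<omega>
  proof -
    have UX: "U \<inter> {0<..<1} \<in> sets X" if "open U" for U
      unfolding X_def sets_restrict_space using that by (intro image_eqI[of _ _ U]) auto
    have "t \<in> {s0, s1}" if t: "t \<in> measure_support (F \<omega>)" for t
    proof (rule ccontr)
      assume nt: "t \<notin> {s0, s1}"
      have "open (- {s0, s1})" by (intro open_Compl finite_imp_closed) auto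
      moreover have "\<forall>U. open U \<and> t \<in> U \<longrightarrow> emeasure (F \<omega>) (U \<inter> {0<..<1}) > 0"
        using t by (simp add: measure_support_def space)
      ultimately have "emeasure (F \<omega>) (- {s0, s1} \<inter> {0<..<1}) > 0"
        using nt by (elim allE[of _ "- {s0, s1}"]) simp
      moreover have "emeasure (F \<omega>) (- {s0, s1} \<inter> {0<..<1}) = 0"
        using emeas_0[OF UX[OF \<open>open (- {s0, s1})\<close>]] by auto
      ultimately show False by simp
    qed
    moreover have "t \<in> measure_support (F \<omega>)" if t: "t \<in> {s0, s1}" for t
      unfolding measure_support_def space
      using s t UX emeas_0[OF UX] by (auto simp: zero_less_iff_neq_zero)
    ultimately show ?thesis by blast
  qed
  have "info_structure F"
    unfolding info_structure_def space
  proof (intro conjI allI ballI)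
    have "E \<in> null_sets (F \<omega>) \<longleftrightarrow> E \<in> sets X \<and> s0 \<notin> E \<and> s1 \<notin> E" for E \<omega>
    proof -
      have "E \<in> null_sets (F \<omega>) \<longleftrightarrow> E \<in> sets X \<and> emeasure (F \<omega>) E = 0"
        by (auto simp: null_sets_def F_def)
      then show ?thesis using emeas_0 by blast
    qed
    then show "absolutely_continuous (F False) (F True)" "absolutely_continuous (F True) (F False)"
      by (simp_all add: absolutely_continuous_def subset_eq)
    fix E assume "E \<in> sets (F False)"
    then have E: "E \<in> sets X" by (simp add: F_def)
    have ident: "(\<lambda>s. s) \<in> borel_measurable X"
      unfolding X_def by (intro measurable_restrict_space1) simp
    have lint: "(LINT s:E|F \<omega>. s) = (1 - p \<omega>) * (indicator E s0 * s0) + p \<omega> * (indicator E s1 * s1)" for \<omega>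
      unfolding set_lebesgue_integral_def
      using E ident by (subst integral) auto
    have "p True * (1 - s1) = s1 * p False"
      using p unfolding s1_eq by (simp add: field_simps)
    moreover have "(1 - p True) * (1 - s0) = s0 * (1 - p False)"
      using p unfolding s0_eq by (simp add: field_simps)
    ultimately show "1 / 2 * measure (F True) E = 1 / 2 * (LINT s:E|F True. s) + 1 / 2 * (LINT s:E|F False. s)"
      unfolding lint meas[OF E] by (auto simp: indicator_def algebra_simps)
  qed (simp, rule prob, rule sets)
  then have "F \<in> binary_info_structures \<delta>"
    using s d by (auto simp: binary_info_structures_def info_structures_def supp)
  moreover have "binary_signals F s0 s1 p"
  proof (rule binary_signals.intro)
    show "AE t in F \<omega>. t = s0 \<or> t = s1" for \<omega>
    proof -
      have "AE t in F \<omega>. t \<in> measure_support (F \<omega>)"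
        unfolding space[of \<omega>] by (rule AE_measure_support) (simp only: sets space)
      then show ?thesis by (simp add: supp)
    qed
    show "measure (F \<omega>) {s0} = 1 - p \<omega>" "measure (F \<omega>) {s1} = p \<omega>" for \<omega>
      using s by (simp_all add: meas single)
    show "sets (F \<omega>) = sets (restrict_space borel (space (F False)))" for \<omega>
      unfolding space by (rule sets)
  qed (use s p in \<open>simp_all add: space prob\<close>)
  ultimately show ?thesis by blast
qed

section \<open>Payoffs generated by messages\<close>

lemma expectation_in_closed_segment:
  fixes f :: "'a \<Rightarrow> real"
  assumes "set_pmf r \<subseteq> {a, b}"
  shows "measure_pmf.expectation r f \<in> closed_segment (f a) (f b)"
proof (cases "a = b")
  case True
  then have "r = return_pmf a"
    using assms by (simp add: set_pmf_subset_singleton)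
  then show ?thesis by simp
next
  case False
  have "(\<Sum>c\<in>{a, b}. pmf r c) = 1"
    using assms by (intro sum_pmf_eq_1) auto
  then have "pmf r a = 1 - pmf r b"
    using False by simp
  moreover have "measure_pmf.expectation r f = pmf r a * f a + pmf r b * f b"
    using assms False by (subst integral_measure_pmf_real[of "{a, b}"]) (auto simp: mult.commute)
  ultimately show ?thesis
    by (auto simp: closed_segment_def pmf_le_1 intro!: exI[of _ "pmf r b"])
qed

lemma expectation_singleton:
  fixes f :: "'a \<Rightarrow> real"
  assumes "set_pmf r \<subseteq> {a}"
  shows "measure_pmf.expectation r f = f a"
  using expectation_in_closed_segment[of r a a f] assms by simp

lemma pmf_with_expectation:
  fixes f :: "'a \<Rightarrow> real"
  assumes "y \<in> closed_segment (f a) (f b)"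
  shows "\<exists>r. set_pmf r \<subseteq> {a, b} \<and> measure_pmf.expectation r f = y"
proof -
  obtain t where t: "0 \<le> t" "t \<le> 1" "y = (1 - t) * f a + t * f b"
    using assms by (auto simp: closed_segment_def)
  define r where "r = map_pmf (\<lambda>c. if c then b else a) (bernoulli_pmf t)"
  have "set_pmf r \<subseteq> {a, b}"
    by (auto simp: r_def)
  moreover have "measure_pmf.expectation r f = y"
    using t by (simp add: r_def)
  ultimately show ?thesis by blast
qed

text \<open>The work is in measurability: as \<open>A\<close> is finite, the expectation is a finite
  sum of the functions whose measurability \<open>receiver_strategy\<close> provides.\<close>

lemma (in binary_signals) message_payoff_eq:
  fixes A :: "'a set"
  assumes rec: "receiver_strategy A F M \<rho>" and "finite A" and m: "m \<in> M"
  shows "message_payoff uS F \<rho> \<omega> m =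
    (1 - p \<omega>) * measure_pmf.expectation (\<rho> m s0) uS + p \<omega> * measure_pmf.expectation (\<rho> m s1) uS"
  unfolding message_payoff_def
proof (rule integral_F)
  have "(\<lambda>s. pmf (\<rho> m s) a) \<in> borel_measurable (F \<omega>)" if "a \<in> A" for a
  proof -
    have "(\<lambda>(m, s). pmf (\<rho> m s) a) \<in> borel_measurable (count_space M \<Otimes>\<^sub>M F False)"
      using rec that by (simp add: receiver_strategy_def)
    from measurable_compose[OF measurable_Pair1' this, of m]
    have "(\<lambda>s. pmf (\<rho> m s) a) \<in> borel_measurable (F False)"
      using m by simp
    moreover have "measurable (F \<omega>) borel = measurable (F False) borel"
      by (intro measurable_cong_sets refl) (rule trans[OF sets_F sets_F[symmetric]])
    ultimately show ?thesis by blast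
  qed
  then have "(\<lambda>s. \<Sum>a\<in>A. uS a * pmf (\<rho> m s) a) \<in> borel_measurable (F \<omega>)"
    by (intro borel_measurable_sum borel_measurable_times borel_measurable_const)
  moreover have "measure_pmf.expectation (\<rho> m s) uS = (\<Sum>a\<in>A. uS a * pmf (\<rho> m s) a)"
    if "s \<in> space (F \<omega>)" for s
    using rec m that \<open>finite A\<close> unfolding receiver_strategy_def space_F[of \<omega>]
    by (intro integral_measure_pmf_real) auto
  ultimately show "(\<lambda>s. measure_pmf.expectation (\<rho> m s) uS) \<in> borel_measurable (F \<omega>)"
    by (rule measurable_cong[THEN iffD2, rotated])
qed

text \<open>
  The pairs of expected payoffs, after the low and the high signal, that a message with posterior
  near the cutoff between \<open>a\<^sub>i\<close> and \<open>a\<^sub>i\<^sub>+\<^sub>1\<close> can generate: an L-shaped path from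
  \<open>(u i, u i)\<close> via \<open>(u i, u (i + 1))\<close> to \<open>(u (i + 1), u (i + 1))\<close>.
\<close>

definition cutoff_payoffs :: "(nat \<Rightarrow> real) \<Rightarrow> nat \<Rightarrow> real \<Rightarrow> real \<Rightarrow> bool" where
  "cutoff_payoffs u i y0 y1 \<longleftrightarrow>
     y0 = u i \<and> y1 \<in> closed_segment (u i) (u (i + 1)) \<or>
     y1 = u (i + 1) \<and> y0 \<in> closed_segment (u i) (u (i + 1))"

lemma strictly_between:
  fixes y :: real
  assumes "y \<in> closed_segment a b" "y \<noteq> a" "y \<noteq> b"
  shows "a < y \<and> y < b \<or> b < y \<and> y < a"
  using assms by (auto simp: closed_segment_eq_real_ivl split: if_splits)

text \<open>A path that starts above its end contains no increasing pair, so an increasing pair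
  spans part of the interval from \<open>u i\<close> up to \<open>u (i + 1)\<close>. This and its
  mirror image supply the order conditions of the set \<open>T\<close>.\<close>

lemma cutoff_payoffs_increasing:
  assumes "cutoff_payoffs u i y0 y1" "y0 < y1"
  shows "u i \<le> y0" "y1 \<le> u (i + 1)"
  using assms by (auto simp: cutoff_payoffs_def closed_segment_eq_real_ivl split: if_splits)

lemma cutoff_payoffs_decreasing:
  assumes "cutoff_payoffs u i y0 y1" "y1 < y0"
  shows "y0 \<le> u i" "u (i + 1) \<le> y1"
  using assms by (auto simp: cutoff_payoffs_def closed_segment_eq_real_ivl split: if_splits)

lemma cutoff_payoffs_const:
  assumes "cutoff_payoffs u i y y"
  shows "y = u i \<or> y = u (i + 1)"
  using assms by (auto simp: cutoff_payoffs_def)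

lemma cutoff_payoffs_left: "cutoff_payoffs u i (u i) (u i)"
  by (simp add: cutoff_payoffs_def)

lemma cutoff_payoffs_right: "cutoff_payoffs u i (u (i + 1)) (u (i + 1))"
  by (simp add: cutoff_payoffs_def)

section \<open>The receiver's actions and the set \<open>Q\<close>\<close>

locale cheap_talk_model =
  fixes A :: "'a set" and act :: "nat \<Rightarrow> 'a" and l j :: nat
    and uR :: "'a \<Rightarrow> bool \<Rightarrow> real" and uS :: "'a \<Rightarrow> real"
    and x :: "nat \<Rightarrow> real" and \<pi> :: real
  assumes act_bij: "bij_betw act {1..l} A"
    and x_0: "x 0 = 0" and x_l: "x l = 1" and x_strict_mono: "strict_mono_on {0..l} x"
    and optimal_Icc: "\<And>i. i \<in> {1..l} \<Longrightarrow> {b \<in> {0..1}. act i \<in> optimal_actions A uR b} = {x (i - 1)..x i}"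
    and uS_inj: "inj_on uS A"
    and prior: "0 < \<pi>" "\<pi> < 1"
    and j_range: "j \<in> {1..l}" and prior_interior: "\<pi> \<in> interior {x (j - 1)..x j}"
begin

abbreviation "opt \<equiv> optimal_actions A uR"

definition u :: "nat \<Rightarrow> real" where "u i = uS (act i)"

lemma finite_A: "finite A"
  using act_bij bij_betw_finite by blast

lemma x_less: "i < k \<Longrightarrow> k \<le> l \<Longrightarrow> x i < x k"
  using x_strict_mono by (simp add: strict_mono_on_def)

lemma x_less_iff: "i \<le> l \<Longrightarrow> k \<le> l \<Longrightarrow> x i < x k \<longleftrightarrow> i < k"
  using x_less[of i k] x_less[of k i] by (cases i k rule: linorder_cases) auto

lemma x_le_iff: "i \<le> l \<Longrightarrow> k \<le> l \<Longrightarrow> x i \<le> x k \<longleftrightarrow> i \<le> k"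
  using x_less_iff[of k i] by (simp add: linorder_not_less[symmetric])

lemma prior_bounds: "x (j - 1) < \<pi>" "\<pi> < x j"
  using prior_interior by (auto simp: interior_atLeastAtMost_real)

lemma act_in: "i \<in> {1..l} \<Longrightarrow> act i \<in> A"
  using act_bij by (auto simp: bij_betw_def)

lemma u_eq_iff: "i \<in> {1..l} \<Longrightarrow> k \<in> {1..l} \<Longrightarrow> u i = u k \<longleftrightarrow> i = k"
  using act_bij uS_inj act_in unfolding u_def bij_betw_def inj_on_def by metis

lemma opt_subset: "opt b \<subseteq> A"
  by (auto simp: optimal_actions_def is_arg_max_def)

lemma act_opt_iff:
  assumes "i \<in> {1..l}" "b \<in> {0..1}"
  shows "act i \<in> opt b \<longleftrightarrow> x (i - 1) \<le> b \<and> b \<le> x i"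
  using optimal_Icc[OF assms(1)] assms(2) by (auto simp: set_eq_iff)

lemma opt_cases:
  assumes "a \<in> opt b" "b \<in> {0..1}"
  obtains i where "i \<in> {1..l}" "a = act i" "x (i - 1) \<le> b" "b \<le> x i"
proof -
  have "a \<in> act ` {1..l}"
    using assms opt_subset act_bij by (auto simp: bij_betw_def)
  then show ?thesis using that act_opt_iff assms by auto
qed

lemma x_range: "i \<le> l \<Longrightarrow> x i \<in> {0..1}"
  using x_le_iff[of 0 i] x_le_iff[of i l] x_0 x_l by auto

lemma opt_interior:
  assumes i: "i \<in> {1..l}" and b: "x (i - 1) < b" "b < x i"
  shows "opt b = {act i}"
proof -
  have "0 \<le> x (i - 1)" "x i \<le> 1" using i x_range[of i] x_range[of "i - 1"] by auto
  then have b01: "b \<in> {0..1}" using b by auto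
  have "a = act i" if "a \<in> opt b" for a
  proof -
    obtain k where k: "k \<in> {1..l}" "a = act k" "x (k - 1) \<le> b" "b \<le> x k"
      using opt_cases[OF \<open>a \<in> opt b\<close> b01] by blast
    have "x (k - 1) < x i" "x (i - 1) < x k" using k b by auto
    then have "k - 1 < i" "i - 1 < k" using k i by (auto simp: x_less_iff)
    then have "k = i" using k(1) i by auto
    then show ?thesis using k by simp
  qed
  moreover have "act i \<in> opt b" using act_opt_iff[OF i b01] b by simp
  ultimately show ?thesis by blast
qed

lemma opt_cutoff:
  assumes i: "1 \<le> i" "i < l"
  shows "opt (x i) = {act i, act (i + 1)}"
proof -
  have "a = act i \<or> a = act (i + 1)" if a: "a \<in> opt (x i)" for a
  proof -
    obtain k where k: "k \<in> {1..l}" "a = act k" "x (k - 1) \<le> x i" "x i \<le> x k"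
      using opt_cases[OF a x_range[of i]] i by auto
    then have "k - 1 \<le> i" "i \<le> k" using i by (auto simp: x_le_iff)
    then have "k = i \<or> k = i + 1" using k(1) by auto
    then show ?thesis using k by auto
  qed
  moreover have "act i \<in> opt (x i)" "act (i + 1) \<in> opt (x i)"
    using i x_range[of i] by (simp_all add: act_opt_iff x_le_iff)
  ultimately show ?thesis by blast
qed

lemma l_pos: "1 \<le> l"
  using j_range by auto

lemma opt_0: "opt 0 = {act 1}"
proof -
  have "a = act 1" if a: "a \<in> opt 0" for a
  proof -
    obtain k where k: "k \<in> {1..l}" "a = act k" "x (k - 1) \<le> 0"
      using opt_cases[OF a] by auto
    then have "x (k - 1) \<le> x 0" using x_0 by simp
    then have "k - 1 \<le> 0" using k by (subst (asm) x_le_iff) auto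
    then have "k = 1" using k(1) by auto
    then show ?thesis using k by simp
  qed
  moreover have "act 1 \<in> opt 0"
    using l_pos x_0 x_range[of 1] by (simp add: act_opt_iff)
  ultimately show ?thesis by blast
qed

lemma opt_1: "opt 1 = {act l}"
proof -
  have "a = act l" if a: "a \<in> opt 1" for a
  proof -
    obtain k where k: "k \<in> {1..l}" "a = act k" "1 \<le> x k"
      using opt_cases[OF a] by auto
    then have "x l \<le> x k" using x_l by simp
    then have "l \<le> k" using k by (subst (asm) x_le_iff) auto
    then have "k = l" using k(1) by auto
    then show ?thesis using k by simp
  qed
  moreover have "act l \<in> opt 1"
    using l_pos x_l x_range[of "l - 1"] by (simp add: act_opt_iff)
  ultimately show ?thesis by blast
qed

text \<open>In the plane of pairs \<open>(y0, y1)\<close>, path \<open>i\<close> has a vertical leg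
  at \<open>y0 = u i\<close> and a horizontal leg at \<open>y1 = u (i + 1)\<close>. By genericity
  two paths never share the line of a vertical or of a horizontal leg, so a common point is where
  the vertical leg of one meets the horizontal leg of the other: \<open>(u i, u (k + 1))\<close> or
  \<open>(u k, u (i + 1))\<close>. That these points lie on both legs amounts to types 3 and 4,
  respectively 1 and 2. For adjacent cutoffs, \<open>i + 1 = k\<close>, only the shared endpoint,
  the constant pair of \<open>a\<^sub>j\<close>, remains.\<close>

lemma cutoff_payoffs_inter:
  assumes i: "1 \<le> i" "i < j" and k: "j \<le> k" "k < l"
    and pi: "cutoff_payoffs u i y0 y1" and pk: "cutoff_payoffs u k y0 y1"
  shows "y0 = u j \<and> y1 = u j \<or>
    (\<exists>t\<in>Q_set act l uS j. y0 = B_matrix uS t 1 \<and> y1 = B_matrix uS t 2)"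
proof -
  have ne: "u i \<noteq> u k" "u i \<noteq> u (i + 1)" "u i \<noteq> u (k + 1)" "u (i + 1) \<noteq> u (k + 1)" "u k \<noteq> u (k + 1)"
    using i k by (auto simp: u_eq_iff)
  show ?thesis
  proof (cases "i + 1 = k")
    case True
    then have "j = k" "i + 1 = j" using i k by auto
    have "y0 = u j \<and> y1 = u j"
      using pi
      unfolding cutoff_payoffs_def
    proof (elim disjE conjE)
      assume y: "y0 = u i" "y1 \<in> closed_segment (u i) (u (i + 1))"
      then have "y1 = u (k + 1)" "u i \<in> closed_segment (u k) (u (k + 1))"
        using pk ne(1) by (auto simp: cutoff_payoffs_def)
      \<comment> \<open>The case is contradictory: \<open>u i\<close> would lie strictly between
        \<open>u k\<close> and \<open>u (k + 1)\<close>, and \<open>u (k + 1)\<close> strictly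
        between \<open>u i\<close> and \<open>u k\<close>.\<close>
      then show ?thesis
        using strictly_between[of "u i" "u k" "u (k + 1)"] strictly_between[of y1 "u i" "u (i + 1)"] y ne True
        by auto
    next
      assume y: "y1 = u (i + 1)" "y0 \<in> closed_segment (u i) (u (i + 1))"
      then have "y0 = u k" using pk ne(4) by (auto simp: cutoff_payoffs_def)
      then show ?thesis using y True \<open>j = k\<close> by simp
    qed
    then show ?thesis ..
  next
    case False
    then have ne': "u (i + 1) \<noteq> u k" using i k by (auto simp: u_eq_iff)
    define t where "t = (act i, act (i + 1), act k, act (k + 1))"
    have *: "(y0 = u i \<and> y1 = u (k + 1) \<and> (quad_type3 uS t \<or> quad_type4 uS t)) \<or>
          (y0 = u k \<and> y1 = u (i + 1) \<and> (quad_type1 uS t \<or> quad_type2 uS t))"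
      using pi
      unfolding cutoff_payoffs_def
    proof (elim disjE conjE)
      assume y: "y0 = u i" "y1 \<in> closed_segment (u i) (u (i + 1))"
      then have "y1 = u (k + 1)" "u i \<in> closed_segment (u k) (u (k + 1))"
        using pk ne(1) by (auto simp: cutoff_payoffs_def)
      then show ?thesis
        using strictly_between[of "u i" "u k" "u (k + 1)"] strictly_between[of y1 "u i" "u (i + 1)"] y ne
        by (auto simp: quad_type3_def quad_type4_def t_def u_def)
    next
      assume y: "y1 = u (i + 1)" "y0 \<in> closed_segment (u i) (u (i + 1))"
      then have "y0 = u k" "u (i + 1) \<in> closed_segment (u k) (u (k + 1))"
        using pk ne(4) by (auto simp: cutoff_payoffs_def)
      then show ?thesis
        using strictly_between[of "u (i + 1)" "u k" "u (k + 1)"] strictly_between[of y0 "u i" "u (i + 1)"] y ne ne'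
        by (auto simp: quad_type1_def quad_type2_def t_def u_def)
    qed
    have "\<not> (quad_type1 uS t \<or> quad_type2 uS t)" if "quad_type3 uS t \<or> quad_type4 uS t"
      using that by (auto simp: quad_type1_def quad_type2_def quad_type3_def quad_type4_def t_def)
    with * have "y0 = B_matrix uS t 1 \<and> y1 = B_matrix uS t 2"
      by (auto simp: B_matrix_def t_def u_def)
    moreover have "t \<in> Q_set act l uS j"
    proof -
      have quad: "quad_type1 uS t \<or> quad_type2 uS t \<or> quad_type3 uS t \<or> quad_type4 uS t"
        using * by blast
      show ?thesis
      unfolding Q_set_def Let_def mem_Collect_eq using i k False quad
      by (intro exI[of _ i] exI[of _ k]) (simp add: t_def)
    qed
    ultimately show ?thesis by blast
  qed
qed

lemma Q_set_cutoff_payoffs: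
  assumes "t \<in> Q_set act l uS j"
  obtains i k where "1 \<le> i" "i < j" "j \<le> k" "k < l"
    "cutoff_payoffs u i (B_matrix uS t 1) (B_matrix uS t 2)"
    "cutoff_payoffs u k (B_matrix uS t 1) (B_matrix uS t 2)"
proof -
  obtain i k where ik: "t = (act i, act (i + 1), act k, act (k + 1))"
    "1 \<le> i" "i + 1 \<le> j" "j \<le> k" "k + 1 \<le> l"
    "quad_type1 uS t \<or> quad_type2 uS t \<or> quad_type3 uS t \<or> quad_type4 uS t"
    using assms by (auto simp: Q_set_def Let_def)
  have "cutoff_payoffs u i (B_matrix uS t 1) (B_matrix uS t 2) \<and>
        cutoff_payoffs u k (B_matrix uS t 1) (B_matrix uS t 2)"
  proof (cases "quad_type1 uS t \<or> quad_type2 uS t")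
    case True
    then have "B_matrix uS t 1 = u k" "B_matrix uS t 2 = u (i + 1)"
      by (simp_all add: B_matrix_def ik(1) u_def)
    moreover have "u i < u k \<and> u k < u (i + 1) \<and> u (i + 1) < u (k + 1) \<or>
        u (k + 1) < u (i + 1) \<and> u (i + 1) < u k \<and> u k < u i"
      using True by (simp add: quad_type1_def quad_type2_def ik(1) u_def)
    ultimately show ?thesis
      by (auto simp: cutoff_payoffs_def closed_segment_eq_real_ivl)
  next
    case False
    then have "B_matrix uS t 1 = u i" "B_matrix uS t 2 = u (k + 1)"
      by (simp_all add: B_matrix_def ik(1) u_def)
    moreover have "u k < u i \<and> u i < u (k + 1) \<and> u (k + 1) < u (i + 1) \<or>
        u (i + 1) < u (k + 1) \<and> u (k + 1) < u i \<and> u i < u k"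
      using ik(6) False by (simp add: quad_type3_def quad_type4_def ik(1) u_def)
    ultimately show ?thesis
      by (auto simp: cutoff_payoffs_def closed_segment_eq_real_ivl)
  qed
  then show ?thesis using that[of i k] ik by auto
qed

end

section \<open>Messages under signals close to 1/2\<close>

text \<open>A signal moves a belief by at most \<open>2 * \<delta>\<close>, so the posteriors after
  the two signals are at most \<open>4 * \<delta>\<close> apart. With wider cells they cannot
  enclose two cutoffs. The same distance from the prior to its cutoffs leaves room for a message
  \<open>2 * \<delta>\<close> away from the prior and a further signal.\<close>

locale binary_persuasion =
  cheap_talk_model A act l j uR uS x \<pi> + binary_signals F s0 s1 p
  for A :: "'a set" and act l j uR uS x \<pi> F s0 s1 p +
  fixes \<delta> :: real
  assumes signals_ge: "1/2 - \<delta> \<le> s0" and signals_le: "s1 \<le> 1/2 + \<delta>"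
    and delta_quarter: "\<delta> \<le> 1/4"
    and delta_gap: "\<And>i. i \<in> {1..l} \<Longrightarrow> 4 * \<delta> < x i - x (i - 1)"
    and delta_prior: "4 * \<delta> < \<pi> - x (j - 1)" "4 * \<delta> < x j - \<pi>"
begin

abbreviation "E r \<equiv> measure_pmf.expectation r uS"

lemma delta_pos: "0 < \<delta>"
  using signals_ge signal_order by linarith

lemma update_s0:
  assumes "0 < m" "m < 1"
  shows "0 < update m s0" "m - 2 * \<delta> \<le> update m s0" "update m s0 < m"
  using abs_update_diff_le[of m \<delta> s0] update_less[of m s0] lr_update(1)[of m s0]
    assms signals_ge signal_order delta_quarter signal_bounds delta_pos by auto

lemma update_s1:
  assumes "0 < m" "m < 1"
  shows "update m s1 < 1" "update m s1 \<le> m + 2 * \<delta>" "m < update m s1"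
  using abs_update_diff_le[of m \<delta> s1] less_update[of m s1] lr_update(2)[of m s1]
    assms signals_le signal_order delta_quarter signal_bounds delta_pos by auto

lemma gap: "1 \<le> i \<Longrightarrow> i \<le> l \<Longrightarrow> x (i - 1) + 4 * \<delta> < x i"
  using delta_gap[of i] by auto

text \<open>The two posteriors are distinct and enclose at most one cutoff, so at most one of them
  hits it. Hence the receiver can mix after at most one of the two signals, which is what makes the
  set of attainable pairs L-shaped.\<close>

lemma interior_message:
  assumes m: "0 < m" "m < 1"
    and r0: "set_pmf r0 \<subseteq> opt (update m s0)" and r1: "set_pmf r1 \<subseteq> opt (update m s1)"
  obtains i where "i \<in> {1..l}" "x (i - 1) < update m s0" "update m s0 \<le> x i"
    "update m s1 < x i \<and> E r0 = u i \<and> E r1 = u i \<or>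
     x i \<le> update m s1 \<and> i < l \<and> cutoff_payoffs u i (E r0) (E r1)"
proof -
  let ?b0 = "update m s0" and ?b1 = "update m s1"
  note b = update_s0[OF m] update_s1[OF m]
  define i where "i = (LEAST n. ?b0 \<le> x n)"
  have ex: "?b0 \<le> x l" using b m x_l by simp
  have le: "?b0 \<le> x i" unfolding i_def using ex by (rule LeastI)
  have "i \<le> l" unfolding i_def using ex by (rule Least_le)
  moreover have "i \<noteq> 0" using le b x_0 by (cases "i = 0") auto
  ultimately have i: "i \<in> {1..l}" by auto
  then have "i - 1 < i" by auto
  then have lt: "x (i - 1) < ?b0"
    using not_less_Least[of "i - 1" "\<lambda>n. ?b0 \<le> x n"] unfolding i_def by simp
  have E_interior: "E r = u n" if "set_pmf r \<subseteq> opt b" "n \<in> {1..l}" "x (n - 1) < b" "b < x n" for r b n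
    using that opt_interior[of n b] expectation_singleton[of r "act n" uS] by (simp add: u_def)
  have E_cutoff: "E r \<in> closed_segment (u n) (u (n + 1))" if "set_pmf r \<subseteq> opt (x n)" "1 \<le> n" "n < l" for r n
    using that opt_cutoff[of n] expectation_in_closed_segment[of r "act n" "act (n + 1)" uS] by (simp add: u_def)
  have "?b1 < x i \<and> E r0 = u i \<and> E r1 = u i \<or> x i \<le> ?b1 \<and> i < l \<and> cutoff_payoffs u i (E r0) (E r1)"
  proof (cases "?b1 < x i")
    case True
    then show ?thesis using E_interior[OF r0 i] E_interior[OF r1 i] lt b by auto
  next
    case False
    then have "i \<noteq> l" using b x_l by auto
    then have il: "1 \<le> i" "i < l" using i by auto
    have b1: "?b1 < x (i + 1)"
      using gap[of "i + 1"] il le b by auto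
    have "cutoff_payoffs u i (E r0) (E r1)"
    proof (cases "?b0 = x i")
      case True
      have "E r1 = u (i + 1)"
        using E_interior[OF r1, of "i + 1"] il b b1 True by auto
      moreover have "E r0 \<in> closed_segment (u i) (u (i + 1))"
        using E_cutoff[of r0 i] r0 il True by simp
      ultimately show ?thesis by (simp add: cutoff_payoffs_def)
    next
      case b0: False
      have E0: "E r0 = u i"
        using E_interior[OF r0 i] lt le b0 by simp
      show ?thesis
      proof (cases "?b1 = x i")
        case True
        then have "E r1 \<in> closed_segment (u i) (u (i + 1))"
          using E_cutoff[of r1 i] r1 il by simp
        then show ?thesis using E0 by (simp add: cutoff_payoffs_def)
      next
        case b1': False
        then have "E r1 = u (i + 1)"
          using E_interior[OF r1, of "i + 1"] il b1 False by auto
        then show ?thesis using E0 by (simp add: cutoff_payoffs_def)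
      qed
    qed
    then show ?thesis using False il by auto
  qed
  then show ?thesis using that i lt le by blast
qed

text \<open>A posterior up to the prior cannot reach the cutoff \<open>x j\<close>, even after the
  high signal. The constant pair of an action \<open>a\<^sub>i\<close> with \<open>i < j\<close>
  counts as the start of path \<open>i\<close>; in the mirrored \<open>high_message\<close>, that of
  \<open>a\<^sub>k\<close> with \<open>k > j\<close> counts as the end of path \<open>k - 1\<close>.
  Only the pair of \<open>a\<^sub>j\<close> needs separate mention.\<close>

lemma low_message:
  assumes m: "0 < m" "m \<le> \<pi>"
    and r0: "set_pmf r0 \<subseteq> opt (update m s0)" and r1: "set_pmf r1 \<subseteq> opt (update m s1)"
  shows "E r0 = u j \<and> E r1 = u j \<or> (\<exists>i. 1 \<le> i \<and> i < j \<and> cutoff_payoffs u i (E r0) (E r1))"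
proof -
  have m1: "m < 1" using m prior by simp
  obtain i where i: "i \<in> {1..l}" "x (i - 1) < update m s0"
    "update m s1 < x i \<and> E r0 = u i \<and> E r1 = u i \<or>
     x i \<le> update m s1 \<and> i < l \<and> cutoff_payoffs u i (E r0) (E r1)"
    by (rule interior_message[OF m(1) m1 r0 r1])
  have "x (i - 1) < x j"
    using i(2) update_s0[OF m(1) m1] m prior_bounds by linarith
  then have "i \<le> j" using i(1) j_range by (auto simp: x_less_iff)
  show ?thesis
  proof (cases "i = j")
    case True
    have "update m s1 < x j"
      using update_s1[OF m(1) m1] m delta_prior delta_pos by linarith
    then show ?thesis using i(3) True by auto
  next
    case False
    then have "1 \<le> i" "i < j" using \<open>i \<le> j\<close> i(1) by auto
    then show ?thesis using i(3) cutoff_payoffs_left[of u i] by auto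
  qed
qed

lemma high_message:
  assumes m: "\<pi> \<le> m" "m < 1"
    and r0: "set_pmf r0 \<subseteq> opt (update m s0)" and r1: "set_pmf r1 \<subseteq> opt (update m s1)"
  shows "E r0 = u j \<and> E r1 = u j \<or> (\<exists>k. j \<le> k \<and> k < l \<and> cutoff_payoffs u k (E r0) (E r1))"
proof -
  have m0: "0 < m" using m prior by simp
  obtain k where k: "k \<in> {1..l}" "update m s0 \<le> x k"
    "update m s1 < x k \<and> E r0 = u k \<and> E r1 = u k \<or>
     x k \<le> update m s1 \<and> k < l \<and> cutoff_payoffs u k (E r0) (E r1)"
    by (rule interior_message[OF m0 m(2) r0 r1])
  have "x (j - 1) < x k"
    using k(2) update_s0[OF m0 m(2)] m delta_prior delta_pos by linarith
  then have "j \<le> k" using k(1) j_range by (auto simp: x_less_iff)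
  show ?thesis
  proof (cases "k = j")
    case True
    then show ?thesis using k(3) by auto
  next
    case False
    then have "j \<le> k - 1" "k - 1 < l" "k - 1 + 1 = k" using \<open>j \<le> k\<close> k(1) by auto
    then show ?thesis using k(3) cutoff_payoffs_right[of u "k - 1"] \<open>j \<le> k\<close> by metis
  qed
qed

text \<open>Converse of \<open>interior_message\<close>: the whole path is attainable close to the
  cutoff. On each leg only one coordinate varies, so the message is placed where the corresponding
  signal leads exactly to the cutoff.\<close>

lemma cutoff_message:
  assumes i: "1 \<le> i" "i < l" and y: "cutoff_payoffs u i y0 y1"
  obtains m r0 r1 where "0 < m" "m < 1" "\<bar>m - x i\<bar> \<le> 2 * \<delta>"
    "set_pmf r0 \<subseteq> opt (update m s0)" "set_pmf r1 \<subseteq> opt (update m s1)" "E r0 = y0" "E r1 = y1"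
proof -
  have xi: "0 < x i" "x i < 1"
    using x_less[of 0 i] x_less[of i l] i x_0 x_l by auto
  \<comment> \<open>Updating the cutoff by \<open>1 - s\<close> undoes signal \<open>s\<close>: after \<open>s\<close> the receiver is indifferent and
    may mix.\<close>
  have near: "0 < update (x i) (1 - s)" "update (x i) (1 - s) < 1"
      "\<bar>update (x i) (1 - s) - x i\<bar> \<le> 2 * \<delta>" "update (update (x i) (1 - s)) s = x i"
    if s: "s = s0 \<or> s = s1" for s
  proof -
    have s01: "0 < s" "s < 1" "1/2 - \<delta> \<le> s" "s \<le> 1/2 + \<delta>"
      using s signal_bounds signals_ge signals_le signal_order by auto
    show "0 < update (x i) (1 - s)" "update (x i) (1 - s) < 1"
      using xi s01 lr_update[of "x i" "1 - s"] by simp_all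
    show "\<bar>update (x i) (1 - s) - x i\<bar> \<le> 2 * \<delta>"
      using xi s01 delta_quarter by (intro abs_update_diff_le) simp_all
    show "update (update (x i) (1 - s)) s = x i"
      using xi s01 by (intro update_complement)
  qed
  have opt_xi: "opt (x i) = {act i, act (i + 1)}"
    using i by (rule opt_cutoff)
  show ?thesis
    using y unfolding cutoff_payoffs_def
  proof (elim disjE conjE)
    assume y0: "y0 = u i" and "y1 \<in> closed_segment (u i) (u (i + 1))"
    then obtain r1 where r1: "set_pmf r1 \<subseteq> {act i, act (i + 1)}" "E r1 = y1"
      using pmf_with_expectation[of y1 uS] unfolding u_def by blast
    define m where "m = update (x i) (1 - s1)"
    have m: "0 < m" "m < 1" "\<bar>m - x i\<bar> \<le> 2 * \<delta>" "update m s1 = x i"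
      using near[of s1] unfolding m_def by simp_all
    have "x (i - 1) < update m s0" "update m s0 < x i"
      using update_s0[OF m(1,2)] update_s1[OF m(1,2)] m(4) gap[of i] i by linarith+
    then have "opt (update m s0) = {act i}"
      using i by (intro opt_interior) auto
    then show thesis
      using r1 y0 m opt_xi by (intro that[of m "return_pmf (act i)" r1]) (simp_all add: u_def)
  next
    assume y1: "y1 = u (i + 1)" and "y0 \<in> closed_segment (u i) (u (i + 1))"
    then obtain r0 where r0: "set_pmf r0 \<subseteq> {act i, act (i + 1)}" "E r0 = y0"
      using pmf_with_expectation[of y0 uS] unfolding u_def by blast
    define m where "m = update (x i) (1 - s0)"
    have m: "0 < m" "m < 1" "\<bar>m - x i\<bar> \<le> 2 * \<delta>" "update m s0 = x i"
      using near[of s0] unfolding m_def by simp_all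
    have "x i < update m s1" "update m s1 < x (i + 1)"
      using update_s0[OF m(1,2)] update_s1[OF m(1,2)] m(4) gap[of "i + 1"] i by auto
    then have "opt (update m s1) = {act (i + 1)}"
      using i by (intro opt_interior) auto
    then show thesis
      using r0 y1 m opt_xi by (intro that[of m r0 "return_pmf (act (i + 1))"]) (simp_all add: u_def)
  qed
qed

end

section \<open>Bounds on equilibrium payoffs\<close>

context binary_persuasion
begin

text \<open>The ex-ante probability of the high signal. If all messages induce the same pair, the
  sender's payoff depends on the structure only through this number, which therefore acts as
  nature's mixture over the two columns of \<open>B\<close>.\<close>

definition "high_signal_prob = (1 - \<pi>) * p False + \<pi> * p True"

definition payoff :: "bool \<Rightarrow> real \<Rightarrow> real \<Rightarrow> real" where
  "payoff \<omega> y0 y1 = (1 - p \<omega>) * y0 + p \<omega> * y1"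

lemma payoff_const [simp]: "payoff \<omega> y y = y"
  by (simp add: payoff_def algebra_simps)

lemma payoff_diff: "payoff True y0 y1 - payoff False y0 y1 = (p True - p False) * (y1 - y0)"
  by (simp add: payoff_def algebra_simps)

lemma expected_payoff:
  "(1 - \<pi>) * payoff False y0 y1 + \<pi> * payoff True y0 y1 = (1 - high_signal_prob) * y0 + high_signal_prob * y1"
  by (simp add: payoff_def high_signal_prob_def algebra_simps)

text \<open>Two linear equations in the pair, with determinant \<open>p True - p False\<close>,
  which is positive.\<close>

lemma payoff_inject:
  assumes "\<And>\<omega>. payoff \<omega> y0 y1 = payoff \<omega> z0 z1"
  shows "y0 = z0 \<and> y1 = z1"
proof -
  have "(p True - p False) * (y1 - y0) = (p True - p False) * (z1 - z0)"
    using assms[of True] assms[of False] by (simp flip: payoff_diff)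
  then have d: "y1 - y0 = z1 - z0" using prob_order by simp
  have "payoff False y0 y1 = y0 + p False * (y1 - y0)" "payoff False z0 z1 = z0 + p False * (z1 - z0)"
    by (simp_all add: payoff_def algebra_simps)
  then have "y0 = z0" using assms[of False] by (simp add: d)
  then show ?thesis using d by simp
qed

lemma payoff_strictly_between:
  assumes "y0 < y1"
  shows "y0 < payoff \<omega> y0 y1" "payoff \<omega> y0 y1 < y1"
proof -
  have "0 < p \<omega> * (y1 - y0)" "0 < (1 - p \<omega>) * (y1 - y0)"
    using assms prob_bounds[of \<omega>] by simp_all
  then show "y0 < payoff \<omega> y0 y1" "payoff \<omega> y0 y1 < y1"
    by (simp_all add: payoff_def algebra_simps)
qed

lemma payoff_swap: "payoff \<omega> y0 y1 = - payoff \<omega> (- y0) (- y1)"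
  by (simp add: payoff_def)

lemma expected_payoff_le_first:
  assumes "payoff False y0 y1 = v" "v \<le> payoff True y0 y1" "y1 - y0 \<le> C"
  shows "(1 - \<pi>) * v + \<pi> * payoff True y0 y1 \<le> v + (p True - p False) * C"
proof -
  have "(1 - \<pi>) * v + \<pi> * payoff True y0 y1 = v + \<pi> * (payoff True y0 y1 - v)"
    by (simp add: algebra_simps)
  also have "\<dots> \<le> v + 1 * (payoff True y0 y1 - v)"
    using assms prior by (intro add_left_mono mult_right_mono) auto
  also have "payoff True y0 y1 - v = (p True - p False) * (y1 - y0)"
    using payoff_diff assms by auto
  also have "v + 1 * \<dots> \<le> v + (p True - p False) * C"
    using assms prob_order by (simp add: mult_left_mono)
  finally show ?thesis .
qed

lemma expected_payoff_le_last:
  assumes "payoff True y0 y1 = v" "v \<le> payoff False y0 y1" "y0 - y1 \<le> C"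
  shows "(1 - \<pi>) * payoff False y0 y1 + \<pi> * v \<le> v + (p True - p False) * C"
proof -
  have "(1 - \<pi>) * payoff False y0 y1 + \<pi> * v = v + (1 - \<pi>) * (payoff False y0 y1 - v)"
    by (simp add: algebra_simps)
  also have "\<dots> \<le> v + 1 * (payoff False y0 y1 - v)"
    using assms prior by (intro add_left_mono mult_right_mono) auto
  also have "payoff False y0 y1 - v = (p True - p False) * (y0 - y1)"
    using payoff_diff[of y0 y1] assms by (simp add: algebra_simps)
  also have "v + 1 * \<dots> \<le> v + (p True - p False) * C"
    using assms prob_order by (simp add: mult_left_mono)
  finally show ?thesis .
qed

lemma equilibrium_payoff_bound:
  assumes eq: "cheap_talk_equilibrium A uR uS \<pi> F M \<sigma> \<rho>"
    and C: "\<forall>i\<in>{1..l}. \<forall>k\<in>{1..l}. u i - u k \<le> C"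
  defines "sp \<equiv> sender_payoff uS \<pi> F M \<sigma> \<rho>" and "K \<equiv> (p True - p False) * C"
  shows "sp \<le> u j + K \<or>
    (\<exists>t\<in>Q_set act l uS j. sp = (1 - high_signal_prob) * B_matrix uS t 1 + high_signal_prob * B_matrix uS t 2) \<or>
    (T1_set act l uS j \<noteq> {} \<and> sp \<le> u 1 + K) \<or> (T2_set act l uS j \<noteq> {} \<and> sp \<le> u l + K)"
proof -
  have K: "0 \<le> K"
    using C[rule_format, of 1 1] l_pos prob_order by (simp add: K_def)
  define y0 y1 where "y0 m = E (\<rho> m s0)" and "y1 m = E (\<rho> m s1)" for m
  define W where "W \<omega> m = payoff \<omega> (y0 m) (y1 m)" for \<omega> m
  have rec: "receiver_strategy A F M \<rho>" and M: "finite M" "M \<subseteq> {0..1}" and \<sigma>: "\<And>\<omega>. set_pmf (\<sigma> \<omega>) \<subseteq> M"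
    and post: "\<And>m. m \<in> M \<Longrightarrow> message_prob \<pi> \<sigma> m > 0 \<Longrightarrow> \<pi> * pmf (\<sigma> True) m / message_prob \<pi> \<sigma> m = m"
    and opt: "\<And>m s. m \<in> M \<Longrightarrow> s \<in> space (F False) \<Longrightarrow> message_prob \<pi> \<sigma> m > 0 \<Longrightarrow> set_pmf (\<rho> m s) \<subseteq> opt (update m s)"
    and ic: "\<And>m \<omega> m'. m \<in> M \<Longrightarrow> pmf (\<sigma> \<omega>) m > 0 \<Longrightarrow> m' \<in> M \<Longrightarrow> message_prob \<pi> \<sigma> m' > 0 \<Longrightarrow>
      message_payoff uS F \<rho> \<omega> m' \<le> message_payoff uS F \<rho> \<omega> m"
    using eq unfolding cheap_talk_equilibrium_def sender_strategy_def by blast+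
  have payoff_W: "message_payoff uS F \<rho> \<omega> m = W \<omega> m" if "m \<in> M" for m \<omega>
    using message_payoff_eq[OF rec finite_A that] by (simp add: W_def payoff_def y0_def y1_def)
  have mp: "message_prob \<pi> \<sigma> m = \<pi> * pmf (\<sigma> True) m + (1 - \<pi>) * pmf (\<sigma> False) m" for m
    by (simp add: message_prob_def UNIV_bool weight_def)
  define sent where "sent m \<longleftrightarrow> m \<in> M \<and> message_prob \<pi> \<sigma> m > 0" for m
  have sentI: "sent m" if "pmf (\<sigma> \<omega>) m > 0" for m \<omega>
  proof -
    have "m \<in> M" using that \<sigma>[of \<omega>] by (auto simp: set_pmf_iff)
    moreover have "0 < (if \<omega> then \<pi> else 1 - \<pi>) * pmf (\<sigma> \<omega>) m" using that prior by simp
    moreover have "0 \<le> \<pi> * pmf (\<sigma> True) m" "0 \<le> (1 - \<pi>) * pmf (\<sigma> False) m"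
      using prior by simp_all
    ultimately show ?thesis by (auto simp: sent_def mp split: if_splits)
  qed
  have bayes: "m * message_prob \<pi> \<sigma> m = \<pi> * pmf (\<sigma> True) m" if "sent m" for m
    using post[of m] that by (simp add: sent_def field_simps)
  have bayes': "(1 - m) * message_prob \<pi> \<sigma> m = (1 - \<pi>) * pmf (\<sigma> False) m" if "sent m" for m
  proof -
    have "(1 - m) * message_prob \<pi> \<sigma> m = message_prob \<pi> \<sigma> m - \<pi> * pmf (\<sigma> True) m"
      by (simp add: left_diff_distrib bayes[OF that])
    then show ?thesis by (simp add: mp algebra_simps)
  qed
  have sent_True: "pmf (\<sigma> True) m > 0" if "sent m" "0 < m" for m
  proof -
    have "0 < m * message_prob \<pi> \<sigma> m" using that by (simp add: sent_def)
    then show ?thesis using bayes[OF that(1)] prior by (simp add: zero_less_mult_iff)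
  qed
  have sent_False: "pmf (\<sigma> False) m > 0" if "sent m" "m < 1" for m
  proof -
    have "0 < (1 - m) * message_prob \<pi> \<sigma> m" using that by (simp add: sent_def)
    then show ?thesis using bayes'[OF that(1)] prior by (simp add: zero_less_mult_iff)
  qed
  have W_le: "W \<omega> m' \<le> W \<omega> m" if "pmf (\<sigma> \<omega>) m > 0" "sent m'" for \<omega> m m'
    using ic[of m \<omega> m'] that sentI[OF that(1)] by (simp add: sent_def payoff_W)
  have opt0: "set_pmf (\<rho> m s0) \<subseteq> opt (update m s0)" and opt1: "set_pmf (\<rho> m s1) \<subseteq> opt (update m s1)"
    if "sent m" for m
    using that signals_in_space opt[of m] by (simp_all add: sent_def)
  have total: "(\<Sum>m\<in>M. pmf (\<sigma> \<omega>) m) = 1" for \<omega>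
    using M \<sigma> by (intro sum_pmf_eq_1) auto
  have sp_eq: "sp = (1 - \<pi>) * W False a + \<pi> * W True b"
    if "pmf (\<sigma> False) a > 0" "pmf (\<sigma> True) b > 0" for a b
  proof -
    have state: "(\<Sum>m\<in>M. pmf (\<sigma> \<omega>) m * message_payoff uS F \<rho> \<omega> m) = W \<omega> c"
      if c: "pmf (\<sigma> \<omega>) c > 0" for \<omega> c
    proof -
      have "pmf (\<sigma> \<omega>) m * message_payoff uS F \<rho> \<omega> m = pmf (\<sigma> \<omega>) m * W \<omega> c" if "m \<in> M" for m
      proof (cases "pmf (\<sigma> \<omega>) m = 0")
        case False
        then have m: "pmf (\<sigma> \<omega>) m > 0" by (simp add: order.not_eq_order_implies_strict)
        have "W \<omega> m = W \<omega> c"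
          using W_le[OF m sentI[OF c]] W_le[OF c sentI[OF m]] by simp
        then show ?thesis by (simp add: payoff_W[OF that])
      qed simp
      then have "(\<Sum>m\<in>M. pmf (\<sigma> \<omega>) m * message_payoff uS F \<rho> \<omega> m) = (\<Sum>m\<in>M. pmf (\<sigma> \<omega>) m * W \<omega> c)"
        by (rule sum.cong[OF refl])
      then show ?thesis by (simp add: total flip: sum_distrib_right)
    qed
    show ?thesis
      unfolding sp_def sender_payoff_def by (simp add: UNIV_bool weight_def state[OF that(1)] state[OF that(2)])
  qed
  \<comment> \<open>The differences sum to 0, and by \<open>sign\<close> each has the sign of
    \<open>m - \<pi>\<close>. So the sent posteriors cannot all lie strictly on one side of the
    prior.\<close>
  have zero_sum: "(\<Sum>m\<in>M. pmf (\<sigma> True) m - pmf (\<sigma> False) m) = 0"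
    by (simp add: sum_subtractf total)
  have sign: "(m - \<pi>) * message_prob \<pi> \<sigma> m = \<pi> * (1 - \<pi>) * (pmf (\<sigma> True) m - pmf (\<sigma> False) m)" if "sent m" for m
  proof -
    have "(m - \<pi>) * message_prob \<pi> \<sigma> m = \<pi> * pmf (\<sigma> True) m - \<pi> * message_prob \<pi> \<sigma> m"
      by (simp add: left_diff_distrib bayes[OF that])
    then show ?thesis by (simp add: mp algebra_simps)
  qed
  have pmf_0: "pmf (\<sigma> \<omega>) m = 0" if "m \<in> M" "\<not> sent m" for \<omega> m
    using sentI[of \<omega> m] that by (metis order.not_eq_order_implies_strict pmf_nonneg)
  have some_sent: "\<exists>m\<in>M. sent m"
    using set_pmf_not_empty[of "\<sigma> True"] \<sigma>[of True] sentI[of True] by (meson ex_in_conv pmf_positive subsetD)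
  have pos: "0 < \<pi> * (1 - \<pi>)" using prior by simp
  have "\<exists>a. sent a \<and> a \<le> \<pi>"
  proof (rule ccontr)
    assume none: "\<not> ?thesis"
    have *: "pmf (\<sigma> True) m - pmf (\<sigma> False) m > 0" if "sent m" for m
    proof -
      have "\<pi> < m" using none that by force
      then have "0 < (m - \<pi>) * message_prob \<pi> \<sigma> m" using that by (simp add: sent_def)
      then have "0 < \<pi> * (1 - \<pi>) * (pmf (\<sigma> True) m - pmf (\<sigma> False) m)" by (simp only: sign[OF that])
      then show ?thesis using pos by (simp only: zero_less_mult_pos)
    qed
    obtain m where m: "m \<in> M" "sent m" using some_sent by blast
    have "0 < (\<Sum>m\<in>M. pmf (\<sigma> True) m - pmf (\<sigma> False) m)"
    proof (rule sum_pos2[where i = m])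
      show "finite M" "m \<in> M" by (fact M(1) m(1))+
      show "0 < pmf (\<sigma> True) m - pmf (\<sigma> False) m" using m(2) by (rule *)
      show "0 \<le> pmf (\<sigma> True) m - pmf (\<sigma> False) m" if "m \<in> M" for m
        using *[of m] pmf_0[OF that] by (cases "sent m") auto
    qed
    then show False using zero_sum by simp
  qed
  then obtain a where a: "sent a" "a \<le> \<pi>" by blast
  have "\<exists>b. sent b \<and> \<pi> \<le> b"
  proof (rule ccontr)
    assume none: "\<not> ?thesis"
    have *: "pmf (\<sigma> False) m - pmf (\<sigma> True) m > 0" if "sent m" for m
    proof -
      have "m < \<pi>" using none that by force
      then have "0 < (\<pi> - m) * message_prob \<pi> \<sigma> m" using that by (simp add: sent_def)
      also have "\<dots> = \<pi> * (1 - \<pi>) * (pmf (\<sigma> False) m - pmf (\<sigma> True) m)"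
        using sign[OF that] by (simp add: algebra_simps)
      finally show ?thesis using pos by (simp only: zero_less_mult_pos)
    qed
    obtain m where m: "m \<in> M" "sent m" using some_sent by blast
    have "0 < (\<Sum>m\<in>M. pmf (\<sigma> False) m - pmf (\<sigma> True) m)"
    proof (rule sum_pos2[where i = m])
      show "finite M" "m \<in> M" by (fact M(1) m(1))+
      show "0 < pmf (\<sigma> False) m - pmf (\<sigma> True) m" using m(2) by (rule *)
      show "0 \<le> pmf (\<sigma> False) m - pmf (\<sigma> True) m" if "m \<in> M" for m
        using *[of m] pmf_0[OF that] by (cases "sent m") auto
    qed
    then show False using zero_sum by (simp add: sum_subtractf)
  qed
  then obtain b where b: "sent b" "\<pi> \<le> b" by blast
  have a01: "0 \<le> a" "a < 1" and b01: "0 < b" "b \<le> 1"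
    using a b prior M(2) by (auto simp: sent_def)
  note a_False = sent_False[OF a(1) a01(2)] and b_True = sent_True[OF b(1) b01(1)]
  have W_0: "W \<omega> 0 = u 1" if "sent 0" for \<omega>
    using opt0[OF that] opt1[OF that] expectation_singleton[of _ "act 1" uS]
    by (simp add: W_def y0_def y1_def opt_0 u_def)
  have W_1: "W \<omega> 1 = u l" if "sent 1" for \<omega>
    using opt0[OF that] opt1[OF that] expectation_singleton[of _ "act l" uS] signal_bounds
    by (simp add: W_def y0_def y1_def opt_1 u_def)
  note low = low_message[OF _ a(2) opt0[OF a(1)] opt1[OF a(1)], folded y0_def y1_def]
  note high = high_message[OF b(2) _ opt0[OF b(1)] opt1[OF b(1)], folded y0_def y1_def]
  consider (interior) "0 < a" "b < 1" | (first) "a = 0" "b < 1" | (last) "0 < a" "b = 1" | (both) "a = 0" "b = 1"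
    using a01 b01 by linarith
  then show ?thesis
  proof cases
    case interior
    note a_True = sent_True[OF a(1) interior(1)] and b_False = sent_False[OF b(1) interior(2)]
    have "W \<omega> a = W \<omega> b" for \<omega>
      using W_le[OF a_True b(1)] W_le[OF b_True a(1)] W_le[OF a_False b(1)] W_le[OF b_False a(1)]
      by (cases \<omega>) simp_all
    then have ab: "y0 a = y0 b" "y1 a = y1 b"
      using payoff_inject unfolding W_def by blast+
    have sp: "sp = (1 - high_signal_prob) * y0 a + high_signal_prob * y1 a"
      using sp_eq[OF a_False a_True] by (simp add: W_def expected_payoff)
    have "y0 a = u j \<and> y1 a = u j \<or> (\<exists>t\<in>Q_set act l uS j. y0 a = B_matrix uS t 1 \<and> y1 a = B_matrix uS t 2)"
      using low[OF interior(1)] high[OF interior(2)] cutoff_payoffs_inter unfolding ab by metis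
    then show ?thesis
    proof (elim disjE bexE conjE)
      assume "y0 a = u j" "y1 a = u j"
      then have "sp = u j" using sp by (simp add: left_diff_distrib)
      then show ?thesis using K by simp
    next
      fix t assume t: "t \<in> Q_set act l uS j" "y0 a = B_matrix uS t 1" "y1 a = B_matrix uS t 2"
      have "sp = (1 - high_signal_prob) * B_matrix uS t 1 + high_signal_prob * B_matrix uS t 2"
        using sp unfolding t .
      with t(1) show ?thesis by blast
    qed
  next
    case first
    note b_False = sent_False[OF b(1) first(2)]
    have sent_0: "sent 0" using a first by simp
    have WF: "W False b = u 1"
      using W_le[OF b_False sent_0] W_le[OF a_False b(1)] first W_0[OF sent_0] by simp
    have WT: "u 1 \<le> W True b"
      using W_le[OF b_True sent_0] W_0[OF sent_0] by simp
    have sp: "sp = (1 - \<pi>) * u 1 + \<pi> * W True b"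
      using sp_eq[OF b_False b_True] WF by simp
    from high[OF first(2)] show ?thesis
    proof (elim disjE exE conjE)
      assume "y0 b = u j" "y1 b = u j"
      then have "W False b = u j" "W True b = u j" by (simp_all add: W_def)
      then show ?thesis using sp WF K by (simp add: algebra_simps)
    next
      fix k assume k: "j \<le> k" "k < l" and path: "cutoff_payoffs u k (y0 b) (y1 b)"
      have k1: "1 \<le> k" using k j_range by auto
      have "0 \<le> (p True - p False) * (y1 b - y0 b)"
        using WF WT by (simp add: W_def flip: payoff_diff)
      then have "y0 b \<le> y1 b" using prob_order by (simp add: zero_le_mult_iff)
      then consider "y0 b = y1 b" | "y0 b < y1 b" by linarith
      then show ?thesis
      proof cases
        case 1
        then have "y1 b = u 1" "W True b = u 1" using WF by (simp_all add: W_def)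
        then have "u 1 = u k \<or> u 1 = u (k + 1)"
          using cutoff_payoffs_const[of u k "u 1"] path 1 by simp
        then have "k = 1" using k k1 by (auto simp: u_eq_iff)
        then have "j = 1" using k j_range by auto
        then show ?thesis using sp K \<open>W True b = u 1\<close> by (simp add: algebra_simps)
      next
        case 2
        note bd = cutoff_payoffs_increasing[OF path 2]
        have btw: "y0 b < u 1" "u 1 < y1 b"
          using payoff_strictly_between[OF 2, of False] WF by (simp_all add: W_def)
        have "u (k + 1) - u k \<le> C" using C[rule_format, of "k + 1" k] k k1 by auto
        then have "sp \<le> u 1 + K"
          using expected_payoff_le_first[of "y0 b" "y1 b" "u 1" C] bd WF WT unfolding sp K_def W_def by auto
        show ?thesis
        \<comment> \<open>For \<open>j = 1\<close> there is no triple of type 1 by definition, but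
          then \<open>u 1\<close> is \<open>u j\<close> and the first alternative applies.\<close>
        proof (cases "j = 1")
          case True
          then show ?thesis using \<open>sp \<le> u 1 + K\<close> by simp
        next
          case False
          have "k \<noteq> 1" using bd btw by auto
          then have "(act 1, act k, act (k + 1)) \<in> T1_set act l uS j"
            using k k1 False j_range bd btw unfolding T1_set_def u_def by fastforce
          then show ?thesis using \<open>sp \<le> u 1 + K\<close> by blast
        qed
      qed
    qed
  next
    case last
    note a_True = sent_True[OF a(1) last(1)]
    have sent_1: "sent 1" using b last by simp
    have WT: "W True a = u l"
      using W_le[OF a_True sent_1] W_le[OF b_True a(1)] last W_1[OF sent_1] by simp
    have WF: "u l \<le> W False a"
      using W_le[OF a_False sent_1] W_1[OF sent_1] by simp
    have sp: "sp = (1 - \<pi>) * W False a + \<pi> * u l"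
      using sp_eq[OF a_False a_True] WT by simp
    from low[OF last(1)] show ?thesis
    proof (elim disjE exE conjE)
      assume "y0 a = u j" "y1 a = u j"
      then have "W False a = u j" "W True a = u j" by (simp_all add: W_def)
      then show ?thesis using sp WT K by (simp add: algebra_simps)
    next
      fix i assume i: "1 \<le> i" "i < j" and path: "cutoff_payoffs u i (y0 a) (y1 a)"
      have il: "i + 1 \<le> l" using i j_range by auto
      have "(p True - p False) * (y1 a - y0 a) \<le> 0"
        using WF WT by (simp add: W_def flip: payoff_diff)
      then have "y1 a \<le> y0 a" using prob_order by (simp add: mult_le_0_iff)
      then consider "y0 a = y1 a" | "y1 a < y0 a" by linarith
      then show ?thesis
      proof cases
        case 1
        then have "y1 a = u l" "W False a = u l" using WT by (simp_all add: W_def)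
        then have "u l = u i \<or> u l = u (i + 1)"
          using cutoff_payoffs_const[of u i "u l"] path 1 by simp
        then have "l = i + 1" using i il by (auto simp: u_eq_iff)
        then have "j = l" using i j_range by auto
        then show ?thesis using sp K \<open>W False a = u l\<close> by (simp add: algebra_simps)
      next
        case 2
        note bd = cutoff_payoffs_decreasing[OF path 2]
        \<comment> \<open>Negating both coordinates turns the decreasing pair into an increasing
          one, to which \<open>payoff_strictly_between\<close> applies.\<close>
        have btw: "y1 a < u l" "u l < y0 a"
          using payoff_strictly_between[of "- y0 a" "- y1 a" True] 2 WT payoff_swap[of True "y0 a" "y1 a"]
          by (simp_all add: W_def)
        have "u i - u (i + 1) \<le> C" using C[rule_format, of i "i + 1"] i il by auto
        then have "sp \<le> u l + K"
          using expected_payoff_le_last[of "y0 a" "y1 a" "u l" C] bd WF WT unfolding sp K_def W_def by auto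
        show ?thesis
        proof (cases "j = l")
          case True
          then show ?thesis using \<open>sp \<le> u l + K\<close> by simp
        next
          case False
          have "i + 1 \<noteq> l" using bd btw by auto
          \<comment> \<open>Triples of type 2 are indexed by their middle action, here the one above
            the cutoff \<open>x i\<close>.\<close>
          then have "(act (i + 1 - 1), act (i + 1), act l) \<in> T2_set act l uS j"
            unfolding T2_set_def mem_Collect_eq using i il False j_range bd btw
            by (intro exI[of _ "i + 1"]) (auto simp: u_def)
          then show ?thesis using \<open>sp \<le> u l + K\<close> by blast
        qed
      qed
    qed
  next
    case both
    then have s: "sent 0" "sent 1" using a b by simp_all
    \<comment> \<open>Each state is revealed by a message with its own extreme action; as neither
      state may envy the other, genericity leaves a single action.\<close>
    have "u l \<le> u 1" "u 1 \<le> u l"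
      using W_le[OF a_False s(2)] W_le[OF b_True s(1)] both W_0[OF s(1)] W_1[OF s(2)] by simp_all
    then have u_l: "u l = u 1" by linarith
    have "l \<in> {1..l}" "1 \<in> {1..l}" using l_pos by auto
    then have "l = 1" using u_l u_eq_iff by blast
    then have "j = 1" using j_range by auto
    have "sp = (1 - \<pi>) * u 1 + \<pi> * u 1"
      using sp_eq[OF a_False b_True] unfolding both W_0[OF s(1)] W_1[OF s(2)] u_l .
    then have "sp = u j" unfolding \<open>j = 1\<close> by (simp add: left_diff_distrib)
    then show ?thesis using K by simp
  qed
qed

end

section \<open>Construction of equilibria\<close>

lemma pmf_map_bernoulli:
  assumes "0 \<le> t" "t \<le> 1" "b \<noteq> a"
  defines "q \<equiv> map_pmf (\<lambda>c. if c then b else a) (bernoulli_pmf t)"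
  shows "pmf q b = t" "pmf q a = 1 - t"
proof -
  have "(\<lambda>c. if c then b else a) -` {b} = {True}" "(\<lambda>c. if c then b else a) -` {a} = {False}"
    using assms by (auto split: if_splits)
  then show "pmf q b = t" "pmf q a = 1 - t"
    using assms by (simp_all add: q_def pmf_map measure_pmf_single)
qed

context binary_persuasion
begin

text \<open>A measurable selection of optimal actions, needed at the signals of probability 0, where
  optimality is still demanded. The bound \<open>1 \<le> n\<close> matters at belief 0, where the
  least index would otherwise be 0, which is no action.\<close>

definition default_action :: "real \<Rightarrow> nat" where
  "default_action b = (LEAST n. 1 \<le> n \<and> b \<le> x n)"

lemma default_action_opt:
  assumes "b \<in> {0..1}"
  shows "act (default_action b) \<in> opt b"
proof -
  let ?P = "\<lambda>n. 1 \<le> n \<and> b \<le> x n"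
  let ?i = "default_action b"
  have ex: "?P l" using assms x_l l_pos by auto
  have i: "?P ?i" unfolding default_action_def using ex by (rule LeastI)
  have il: "?i \<le> l" unfolding default_action_def using ex by (rule Least_le)
  have "x (?i - 1) \<le> b"
  proof (cases "?i = 1")
    case True
    then show ?thesis using x_0 assms by simp
  next
    case False
    then have "?i - 1 < ?i" "1 \<le> ?i - 1" using i by auto
    then have "\<not> b \<le> x (?i - 1)"
      using not_less_Least[of "?i - 1" ?P] unfolding default_action_def by blast
    then show ?thesis by simp
  qed
  then show ?thesis using i il assms by (subst act_opt_iff) auto
qed

lemma measurable_default_action:
  "(\<lambda>s. default_action (update m s)) \<in> measurable borel (count_space UNIV)"
  unfolding default_action_def update_def by measurable

text \<open>One construction serves all the lower bounds. State 0 always sends \<open>m1\<close> and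
  state 1 always sends \<open>m2\<close> with positive probability, which requires the first two
  incentive conditions. The reverse conditions arise only if the message is also sent in the other
  state, that is, if \<open>m1\<close> is not 0 or \<open>m2\<close> is not 1.\<close>

lemma two_message_equilibrium:
  assumes m: "0 \<le> m1" "m1 < \<pi>" "\<pi> < m2" "m2 \<le> 1"
    and r1: "set_pmf r10 \<subseteq> opt (update m1 s0)" "set_pmf r11 \<subseteq> opt (update m1 s1)"
    and r2: "set_pmf r20 \<subseteq> opt (update m2 s0)" "set_pmf r21 \<subseteq> opt (update m2 s1)"
    and ic: "payoff False (E r20) (E r21) \<le> payoff False (E r10) (E r11)"
      "payoff True (E r10) (E r11) \<le> payoff True (E r20) (E r21)"
      "0 < m1 \<Longrightarrow> payoff True (E r20) (E r21) \<le> payoff True (E r10) (E r11)"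
      "m2 < 1 \<Longrightarrow> payoff False (E r10) (E r11) \<le> payoff False (E r20) (E r21)"
  shows "ereal ((1 - \<pi>) * payoff False (E r10) (E r11) + \<pi> * payoff True (E r20) (E r21))
    \<le> equilibrium_value A uR uS \<pi> F"
proof -
  \<comment> \<open>Posteriors must average to the prior,
    \<open>q * m2 + (1 - q) * m1 = \<pi>\<close>, so \<open>q\<close> is the total probability of
    \<open>m2\<close>; below, \<open>t\<close> is its probability given the state.\<close>
  define q where "q = (\<pi> - m1) / (m2 - m1)"
  have q: "0 < q" "q < 1" "q * (m2 - m1) = \<pi> - m1"
    using m by (simp_all add: q_def field_simps)
  have q1: "(1 - q) * m1 = \<pi> - q * m2" and q0: "(1 - q) * (1 - m1) = (1 - \<pi>) - q * (1 - m2)"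
    using q(3) by (simp_all add: algebra_simps)
  define t where "t \<omega> = (if \<omega> then q * m2 / \<pi> else q * (1 - m2) / (1 - \<pi>))" for \<omega>
  have t_nonneg: "0 \<le> t \<omega>" for \<omega>
    using q m prior by (simp add: t_def)
  have "0 \<le> (1 - q) * m1" "0 \<le> (1 - q) * (1 - m1)"
    using q m prior by simp_all
  then have t_le: "t \<omega> \<le> 1" for \<omega>
    unfolding q1 q0 using prior by (simp add: t_def field_simps)
  define \<sigma> where "\<sigma> \<omega> = map_pmf (\<lambda>c. if c then m2 else m1) (bernoulli_pmf (t \<omega>))" for \<omega>
  have m12: "m2 \<noteq> m1" using m by simp
  have pmf: "pmf (\<sigma> \<omega>) m2 = t \<omega>" "pmf (\<sigma> \<omega>) m1 = 1 - t \<omega>" for \<omega>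
    unfolding \<sigma>_def using pmf_map_bernoulli[OF t_nonneg t_le m12] by auto
  have mp: "message_prob \<pi> \<sigma> m = \<pi> * pmf (\<sigma> True) m + (1 - \<pi>) * pmf (\<sigma> False) m" for m
    by (simp add: message_prob_def UNIV_bool weight_def)
  have t_eq: "\<pi> * t True = q * m2" "(1 - \<pi>) * t False = q * (1 - m2)"
    using prior by (simp_all add: t_def)
  have mp2: "message_prob \<pi> \<sigma> m2 = q"
    unfolding mp pmf t_eq by (simp add: algebra_simps)
  have t_eq': "\<pi> * (1 - t True) = (1 - q) * m1"
    unfolding q1 right_diff_distrib t_eq by simp
  have mp1: "message_prob \<pi> \<sigma> m1 = 1 - q"
    unfolding mp pmf right_diff_distrib t_eq by (simp add: algebra_simps)
  define M where "M = {m1, m2}"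
  have strategy: "sender_strategy \<pi> M \<sigma>"
    unfolding sender_strategy_def
  proof (intro conjI ballI impI allI)
    show "finite M" "M \<subseteq> {0..1}" using m prior by (auto simp: M_def)
    show "set_pmf (\<sigma> \<omega>) \<subseteq> M" for \<omega> by (auto simp: \<sigma>_def M_def)
    fix m assume "m \<in> M"
    then show "\<pi> * pmf (\<sigma> True) m / message_prob \<pi> \<sigma> m = m"
      using q by (auto simp: M_def mp1 mp2 pmf t_eq t_eq')
  qed
  define \<rho> where "\<rho> m s = (if s = s0 then (if m = m1 then r10 else r20)
      else if s = s1 then (if m = m1 then r11 else r21)
      else return_pmf (act (default_action (update m s))))" for m s
  have optimal: "set_pmf (\<rho> m s) \<subseteq> opt (update m s)" if "m \<in> M" "s \<in> space (F False)" for m s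
  proof -
    have "update m s \<in> {0..1}"
      using that m prior space_F_subset by (intro update_in_Icc) (auto simp: M_def)
    then have "act (default_action (update m s)) \<in> opt (update m s)"
      by (rule default_action_opt)
    then show ?thesis
      using r1 r2 that signal_order by (auto simp: \<rho>_def M_def)
  qed
  have receiver: "receiver_strategy A F M \<rho>"
    unfolding receiver_strategy_def
  proof (intro conjI ballI)
    show "set_pmf (\<rho> m s) \<subseteq> A" if "m \<in> M" "s \<in> space (F False)" for m s
      using optimal[OF that] opt_subset by blast
    fix a assume "a \<in> A"
    have "(\<lambda>s. pmf (\<rho> m s) a) \<in> borel_measurable (F False)" for m
    proof -
      have "(\<lambda>n. pmf (return_pmf (act n)) a) \<in> borel_measurable (count_space UNIV)"
        by simp
      from measurable_compose[OF measurable_default_action this]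
      have "(\<lambda>s. pmf (return_pmf (act (default_action (update m s)))) a) \<in> borel_measurable borel" .
      then have "(\<lambda>s. if s = s0 then pmf (if m = m1 then r10 else r20) a
          else if s = s1 then pmf (if m = m1 then r11 else r21) a
          else pmf (return_pmf (act (default_action (update m s)))) a) \<in> borel_measurable borel"
        by (intro measurable_If measurable_const) simp_all
      moreover have "(\<lambda>s. if s = s0 then pmf (if m = m1 then r10 else r20) a
          else if s = s1 then pmf (if m = m1 then r11 else r21) a
          else pmf (return_pmf (act (default_action (update m s)))) a) = (\<lambda>s. pmf (\<rho> m s) a)"
        by (auto simp: \<rho>_def)
      ultimately have "(\<lambda>s. pmf (\<rho> m s) a) \<in> borel_measurable (restrict_space borel (space (F False)))"
        by (intro measurable_restrict_space1) simp
      moreover have "measurable (F False) borel = measurable (restrict_space borel (space (F False))) borel"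
        by (intro measurable_cong_sets refl sets_F)
      ultimately show ?thesis by blast
    qed
    then show "(\<lambda>(m, s). pmf (\<rho> m s) a) \<in> borel_measurable (count_space M \<Otimes>\<^sub>M F False)"
      by (intro measurable_pair_measure_countable1) (auto simp: M_def)
  qed
  define W where "W \<omega> m = message_payoff uS F \<rho> \<omega> m" for \<omega> m
  have s01: "s1 \<noteq> s0" using signal_order by simp
  have W: "W \<omega> m1 = payoff \<omega> (E r10) (E r11)" "W \<omega> m2 = payoff \<omega> (E r20) (E r21)" for \<omega>
    using message_payoff_eq[OF receiver finite_A, where m = m1] message_payoff_eq[OF receiver finite_A, where m = m2] m12 s01
    by (simp_all add: W_def M_def payoff_def \<rho>_def)
  have m1_True: "W True m2 \<le> W True m1" if "0 < pmf (\<sigma> True) m1"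
  proof -
    have "0 < (1 - q) * m1"
      using that prior unfolding pmf t_eq'[symmetric] by simp
    then have "0 < m1" using q by (simp add: zero_less_mult_iff)
    then show ?thesis unfolding W by (rule ic(3))
  qed
  have m2_False: "W False m1 \<le> W False m2" if "0 < pmf (\<sigma> False) m2"
  proof -
    have "0 < q * (1 - m2)"
      using that prior unfolding pmf t_eq(2)[symmetric] by simp
    then have "m2 < 1" using q by (simp add: zero_less_mult_iff)
    then show ?thesis unfolding W by (rule ic(4))
  qed
  have incentive: "W \<omega> m' \<le> W \<omega> m" if "m \<in> M" "m' \<in> M" "0 < pmf (\<sigma> \<omega>) m" for m m' \<omega>
    using that m1_True m2_False ic(1,2)[folded W] by (cases \<omega>) (auto simp: M_def)
  have eq: "cheap_talk_equilibrium A uR uS \<pi> F M \<sigma> \<rho>"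
    unfolding cheap_talk_equilibrium_def W_def[symmetric]
    using strategy receiver optimal incentive by blast
  have True_eq: "(\<Sum>m\<in>M. pmf (\<sigma> True) m * W True m) = W True m2"
  proof -
    have "pmf (\<sigma> True) m1 * W True m1 = pmf (\<sigma> True) m1 * W True m2"
      using m1_True ic(2)[folded W] pmf_nonneg[of "\<sigma> True" m1] by (cases "pmf (\<sigma> True) m1 = 0") auto
    then show ?thesis using m12 by (simp add: M_def pmf algebra_simps)
  qed
  have False_eq: "(\<Sum>m\<in>M. pmf (\<sigma> False) m * W False m) = W False m1"
  proof -
    have "pmf (\<sigma> False) m2 * W False m2 = pmf (\<sigma> False) m2 * W False m1"
      using m2_False ic(1)[folded W] pmf_nonneg[of "\<sigma> False" m2] by (cases "pmf (\<sigma> False) m2 = 0") auto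
    then show ?thesis using m12 by (simp add: M_def pmf algebra_simps)
  qed
  have "sender_payoff uS \<pi> F M \<sigma> \<rho> =
      (1 - \<pi>) * payoff False (E r10) (E r11) + \<pi> * payoff True (E r20) (E r21)"
    unfolding sender_payoff_def W_def[symmetric]
    by (simp add: UNIV_bool weight_def True_eq False_eq W)
  then show ?thesis
    unfolding equilibrium_value_def using eq
    by (intro SUP_upper2[of "(M, \<sigma>, \<rho>)"]) auto
qed

text \<open>Instead of a single uninformative message, two posteriors \<open>2 * \<delta>\<close>
  from the prior are used, to fit \<open>two_message_equilibrium\<close>. A signal moves them by at
  most another \<open>2 * \<delta>\<close>, so the receiver chooses \<open>a\<^sub>j\<close> in
  every case.\<close>

lemma equilibrium_value_ge_default: "ereal (u j) \<le> equilibrium_value A uR uS \<pi> F"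
proof -
  define m1 m2 where "m1 = \<pi> - 2 * \<delta>" and "m2 = \<pi> + 2 * \<delta>"
  have "x (j - 1) < m1" "m2 < x j" using delta_prior delta_pos by (simp_all add: m1_def m2_def)
  moreover have "0 \<le> x (j - 1)" "x j \<le> 1"
    using x_range[of "j - 1"] x_range[of j] j_range by auto
  ultimately have m: "0 < m1" "m1 < 1" "0 < m2" "m2 < 1" "m1 < \<pi>" "\<pi> < m2"
    using delta_pos prior by (simp_all add: m1_def m2_def)
  have "opt (update m1 s0) = {act j}" "opt (update m1 s1) = {act j}"
    "opt (update m2 s0) = {act j}" "opt (update m2 s1) = {act j}"
    using update_s0[OF m(1,2)] update_s1[OF m(1,2)] update_s0[OF m(3,4)] update_s1[OF m(3,4)]
      delta_prior delta_pos unfolding m1_def m2_def by (intro opt_interior j_range; linarith)+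
  then show ?thesis
    using two_message_equilibrium[of m1 m2 "return_pmf (act j)" "return_pmf (act j)" "return_pmf (act j)" "return_pmf (act j)"] m
    by (simp add: u_def algebra_simps)
qed

lemma equilibrium_value_ge_Q:
  assumes "t \<in> Q_set act l uS j"
  shows "ereal ((1 - high_signal_prob) * B_matrix uS t 1 + high_signal_prob * B_matrix uS t 2) \<le> equilibrium_value A uR uS \<pi> F"
proof -
  obtain i k where ik: "1 \<le> i" "i < j" "j \<le> k" "k < l"
    "cutoff_payoffs u i (B_matrix uS t 1) (B_matrix uS t 2)"
    "cutoff_payoffs u k (B_matrix uS t 1) (B_matrix uS t 2)"
    using assms by (rule Q_set_cutoff_payoffs)
  have il: "i < l" and k1: "1 \<le> k" using ik by auto
  obtain m1 r10 r11 where m1: "0 < m1" "m1 < 1" "\<bar>m1 - x i\<bar> \<le> 2 * \<delta>"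
    "set_pmf r10 \<subseteq> opt (update m1 s0)" "set_pmf r11 \<subseteq> opt (update m1 s1)"
    "E r10 = B_matrix uS t 1" "E r11 = B_matrix uS t 2"
    by (rule cutoff_message[OF ik(1) il ik(5)])
  obtain m2 r20 r21 where m2: "0 < m2" "m2 < 1" "\<bar>m2 - x k\<bar> \<le> 2 * \<delta>"
    "set_pmf r20 \<subseteq> opt (update m2 s0)" "set_pmf r21 \<subseteq> opt (update m2 s1)"
    "E r20 = B_matrix uS t 1" "E r21 = B_matrix uS t 2"
    by (rule cutoff_message[OF k1 ik(4) ik(6)])
  have "x i \<le> x (j - 1)" "x j \<le> x k" using ik by (auto simp: x_le_iff)
  then have "m1 < \<pi>" "\<pi> < m2" using m1(3) m2(3) delta_prior delta_pos by (simp_all add: abs_le_iff)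
  then show ?thesis
    using two_message_equilibrium[of m1 m2 r10 r11 r20 r21] m1 m2 by (simp add: expected_payoff)
qed

text \<open>Along the path \<open>payoff \<omega>\<close> runs monotonically from \<open>u i\<close>
  to \<open>u (i + 1)\<close>, so it takes every value in between. The corner is reached after the
  fraction \<open>p \<omega>\<close> of the way, and this decides which leg contains the
  point.\<close>

lemma cutoff_payoffs_with_payoff:
  assumes "v \<in> closed_segment (u i) (u (i + 1))"
  obtains y0 y1 where "cutoff_payoffs u i y0 y1" "payoff \<omega> y0 y1 = v"
    "u i \<le> u (i + 1) \<Longrightarrow> y0 \<le> y1" "u (i + 1) \<le> u i \<Longrightarrow> y1 \<le> y0"
proof -
  obtain t where t: "0 \<le> t" "t \<le> 1" "v = u i + t * (u (i + 1) - u i)"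
    using assms by (auto simp: closed_segment_def algebra_simps)
  show ?thesis
  proof (cases "t \<le> p \<omega>")
    case True
    define r where "r = t / p \<omega>"
    have r: "0 \<le> r" "r \<le> 1" "r * p \<omega> = t"
      using True t prob_bounds[of \<omega>] by (simp_all add: r_def)
    define y where "y = u i + r * (u (i + 1) - u i)"
    have "y \<in> closed_segment (u i) (u (i + 1))"
      using r by (auto simp: closed_segment_def y_def algebra_simps)
    moreover have "payoff \<omega> (u i) y = u i + (r * p \<omega>) * (u (i + 1) - u i)"
      by (simp add: payoff_def y_def algebra_simps)
    ultimately show ?thesis
      using t r by (intro that[of "u i" y]) (auto simp: cutoff_payoffs_def y_def mult_nonneg_nonpos)
  next
    case False
    define r where "r = (t - p \<omega>) / (1 - p \<omega>)"
    have r: "0 \<le> r" "r \<le> 1" "r * (1 - p \<omega>) = t - p \<omega>"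
      using False t prob_bounds[of \<omega>] by (simp_all add: r_def)
    define y where "y = u i + r * (u (i + 1) - u i)"
    have "y \<in> closed_segment (u i) (u (i + 1))"
      using r by (auto simp: closed_segment_def y_def algebra_simps)
    moreover have "payoff \<omega> y (u (i + 1)) = u i + (r * (1 - p \<omega>) + p \<omega>) * (u (i + 1) - u i)"
      by (simp add: payoff_def y_def algebra_simps)
    moreover have *: "u (i + 1) - y = (1 - r) * (u (i + 1) - u i)"
      by (simp add: y_def algebra_simps)
    moreover have "y \<le> u (i + 1)" if "u i \<le> u (i + 1)"
    proof -
      have "0 \<le> (1 - r) * (u (i + 1) - u i)" using r that by simp
      then show ?thesis unfolding *[symmetric] by simp
    qed
    moreover have "u (i + 1) \<le> y" if "u (i + 1) \<le> u i"
    proof -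
      have "(1 - r) * (u (i + 1) - u i) \<le> 0" using r that by (simp add: mult_nonneg_nonpos)
      then show ?thesis unfolding *[symmetric] by simp
    qed
    ultimately show ?thesis
      using t r by (intro that[of y "u (i + 1)"]) (auto simp: cutoff_payoffs_def)
  qed
qed

text \<open>State 0 must be indifferent between revealing itself and pooling near the cutoff, so the
  pair is chosen to give exactly \<open>u 1\<close> in state 0. As it increases, state 1 obtains at
  least \<open>u 1\<close> from it and is content with the pooling message.\<close>

lemma equilibrium_value_ge_first:
  assumes "T1_set act l uS j \<noteq> {}"
  shows "ereal (u 1) \<le> equilibrium_value A uR uS \<pi> F"
proof -
  obtain i where i: "1 < i" "i < l" "j \<le> i" "u i < u 1" "u 1 < u (i + 1)"
    using assms by (auto simp: T1_set_def u_def)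
  then have "u 1 \<in> closed_segment (u i) (u (i + 1))" "u i \<le> u (i + 1)"
    by (auto simp: closed_segment_eq_real_ivl)
  then obtain y0 y1 where y: "cutoff_payoffs u i y0 y1" "payoff False y0 y1 = u 1" "y0 \<le> y1"
    by (metis cutoff_payoffs_with_payoff)
  have i1: "1 \<le> i" using i by simp
  obtain m r0 r1 where m: "0 < m" "m < 1" "\<bar>m - x i\<bar> \<le> 2 * \<delta>"
    "set_pmf r0 \<subseteq> opt (update m s0)" "set_pmf r1 \<subseteq> opt (update m s1)" "E r0 = y0" "E r1 = y1"
    by (rule cutoff_message[OF i1 i(2) y(1)])
  have "x j \<le> x i" using i j_range by (auto simp: x_le_iff)
  then have "\<pi> < m" using m(3) delta_prior delta_pos by (simp add: abs_le_iff)
  have "0 \<le> (p True - p False) * (y1 - y0)" using y prob_order by simp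
  then have ge: "u 1 \<le> payoff True y0 y1" using y(2) by (simp flip: payoff_diff)
  have "ereal ((1 - \<pi>) * u 1 + \<pi> * payoff True y0 y1) \<le> equilibrium_value A uR uS \<pi> F"
    using two_message_equilibrium[of 0 m "return_pmf (act 1)" "return_pmf (act 1)" r0 r1] m ge y
      \<open>\<pi> < m\<close> prior by (simp add: opt_0 u_def)
  moreover have "u 1 \<le> (1 - \<pi>) * u 1 + \<pi> * payoff True y0 y1"
    using mult_left_mono[OF ge, of \<pi>] prior by (simp add: algebra_simps)
  ultimately show ?thesis by (meson ereal_less_eq(3) order_trans)
qed

lemma equilibrium_value_ge_last:
  assumes "T2_set act l uS j \<noteq> {}"
  shows "ereal (u l) \<le> equilibrium_value A uR uS \<pi> F"
proof -
  obtain n where n: "1 < n" "n < l" "n \<le> j" "j < l" "u n < u l" "u l < u (n - 1)"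
    using assms by (auto simp: T2_set_def u_def)
  define i where "i = n - 1"
  then have i: "1 \<le> i" "i < l" "i \<le> j - 1" "u (i + 1) < u l" "u l < u i"
    using n by auto
  then have "u l \<in> closed_segment (u i) (u (i + 1))" "u (i + 1) \<le> u i"
    by (auto simp: closed_segment_eq_real_ivl)
  then obtain y0 y1 where y: "cutoff_payoffs u i y0 y1" "payoff True y0 y1 = u l" "y1 \<le> y0"
    by (metis cutoff_payoffs_with_payoff)
  obtain m r0 r1 where m: "0 < m" "m < 1" "\<bar>m - x i\<bar> \<le> 2 * \<delta>"
    "set_pmf r0 \<subseteq> opt (update m s0)" "set_pmf r1 \<subseteq> opt (update m s1)" "E r0 = y0" "E r1 = y1"
    by (rule cutoff_message[OF i(1,2) y(1)])
  have "x i \<le> x (j - 1)" using i j_range by (auto simp: x_le_iff)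
  then have "m < \<pi>" using m(3) delta_prior delta_pos by (simp add: abs_le_iff)
  have "(p True - p False) * (y1 - y0) \<le> 0" using y prob_order by (simp add: mult_nonneg_nonpos)
  then have ge: "u l \<le> payoff False y0 y1" using y(2) by (simp flip: payoff_diff)
  have "ereal ((1 - \<pi>) * payoff False y0 y1 + \<pi> * u l) \<le> equilibrium_value A uR uS \<pi> F"
    using two_message_equilibrium[of m 1 r0 r1 "return_pmf (act l)" "return_pmf (act l)"] m ge y
      \<open>m < \<pi>\<close> prior signal_bounds by (simp add: opt_1 u_def)
  moreover have "u l \<le> (1 - \<pi>) * payoff False y0 y1 + \<pi> * u l"
    using mult_left_mono[OF ge, of "1 - \<pi>"] prior by (simp add: algebra_simps)
  ultimately show ?thesis by (meson ereal_less_eq(3) order_trans)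
qed

end

section \<open>The robust value\<close>

context cheap_talk_model
begin

definition robust_value :: ereal where
  "robust_value = Max {v_first act l uS j, v_last act l uS j, Val_B act l uS j, ereal (u j)}"

lemma robust_value_ge:
  "ereal (u j) \<le> robust_value" "v_first act l uS j \<le> robust_value"
  "v_last act l uS j \<le> robust_value" "Val_B act l uS j \<le> robust_value"
  unfolding robust_value_def by (rule Max_ge; simp)+

lemma finite_Q_set: "finite (Q_set act l uS j)"
proof (rule finite_subset)
  show "Q_set act l uS j \<subseteq> (\<lambda>(i, k). (act i, act (i + 1), act k, act (k + 1))) ` ({..l} \<times> {..l})"
    unfolding Q_set_def by force
qed simp

lemma robust_value_le_equilibrium_value:
  assumes "binary_persuasion A act l j uR uS x \<pi> F s0 s1 p \<delta>"
  shows "robust_value \<le> equilibrium_value A uR uS \<pi> F"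
proof -
  interpret binary_persuasion A act l j uR uS x \<pi> F s0 s1 p \<delta> by fact
  have "Val_B act l uS j \<le> equilibrium_value A uR uS \<pi> F"
  proof (cases "Q_set act l uS j = {}")
    case False
    obtain v where v: "game_value (Q_set act l uS j) {1, 2} (B_matrix uS) = ereal v"
      "\<And>t. 0 \<le> t \<Longrightarrow> t \<le> 1 \<Longrightarrow> \<exists>r\<in>Q_set act l uS j. v \<le> (1 - t) * B_matrix uS r 1 + t * B_matrix uS r 2"
      using game_value_two_columns[OF finite_Q_set False, of "B_matrix uS"] by blast
    have "0 \<le> high_signal_prob" "0 \<le> 1 - high_signal_prob"
    proof -
      have "1 - high_signal_prob = (1 - \<pi>) * (1 - p False) + \<pi> * (1 - p True)"
        by (simp add: high_signal_prob_def algebra_simps)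
      then show "0 \<le> high_signal_prob" "0 \<le> 1 - high_signal_prob"
        using prior prob_bounds[of True] prob_bounds[of False] by (simp_all add: high_signal_prob_def)
    qed
    then obtain t where t: "t \<in> Q_set act l uS j" "v \<le> (1 - high_signal_prob) * B_matrix uS t 1 + high_signal_prob * B_matrix uS t 2"
      using v(2)[of high_signal_prob] by auto
    then have "ereal v \<le> equilibrium_value A uR uS \<pi> F"
      using equilibrium_value_ge_Q[OF t(1)] by (meson ereal_less_eq(3) order_trans)
    then show ?thesis using False by (simp only: Val_B_def v(1) if_False)
  qed (simp add: Val_B_def)
  moreover have "v_first act l uS j \<le> equilibrium_value A uR uS \<pi> F"
    using equilibrium_value_ge_first by (simp add: v_first_def u_def)
  moreover have "v_last act l uS j \<le> equilibrium_value A uR uS \<pi> F"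
    using equilibrium_value_ge_last by (simp add: v_last_def u_def)
  ultimately show ?thesis
    using equilibrium_value_ge_default by (simp add: robust_value_def)
qed

text \<open>The threshold depends only on the cutoffs and the prior, so one \<delta> serves all
  structures at once, as the infimum over structures requires.\<close>

lemma eventually_binary_persuasion:
  "eventually (\<lambda>\<delta>. \<forall>F s0 s1 p. binary_signals F s0 s1 p \<and> 1/2 - \<delta> \<le> s0 \<and> s1 \<le> 1/2 + \<delta> \<longrightarrow>
     binary_persuasion A act l j uR uS x \<pi> F s0 s1 p \<delta>) (at_right 0)"
proof -
  have small: "eventually (\<lambda>\<delta>::real. 4 * \<delta> < c) (at_right 0)" if "0 < c" for c
    using that by (intro eventually_at_rightI[of 0 "c / 4"]) auto
  have "eventually (\<lambda>\<delta>. \<forall>i\<in>{1..l}. 4 * \<delta> < x i - x (i - 1)) (at_right 0)"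
    using x_less by (intro eventually_ball_finite ballI small) auto
  moreover have "eventually (\<lambda>\<delta>. 4 * \<delta> < \<pi> - x (j - 1)) (at_right 0)"
    using prior_bounds by (intro small) auto
  moreover have "eventually (\<lambda>\<delta>. 4 * \<delta> < x j - \<pi>) (at_right 0)"
    using prior_bounds by (intro small) auto
  moreover have "eventually (\<lambda>\<delta>. 4 * \<delta> < (1::real)) (at_right 0)"
    by (intro small) auto
  ultimately show ?thesis
  proof eventually_elim
    case (elim \<delta>)
    then show ?case
      by (auto intro!: binary_persuasion.intro binary_persuasion_axioms.intro cheap_talk_model_axioms)
  qed
qed

lemma u_diff_bound: "\<exists>C. \<forall>i\<in>{1..l}. \<forall>k\<in>{1..l}. u i - u k \<le> C"
proof (intro exI ballI)
  fix i k assume "i \<in> {1..l}" "k \<in> {1..l}"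
  then show "u i - u k \<le> Max ((\<lambda>(i, k). u i - u k) ` ({1..l} \<times> {1..l}))"
    by (intro Max_ge) auto
qed

text \<open>
  Nature chooses the probability of the high signal close to the minimizing mixture of the two
  columns of \<open>B\<close>, and makes it almost independent of the state.
\<close>

lemma equilibrium_value_le_robust_value:
  assumes "0 < e"
  shows "eventually (\<lambda>\<delta>. \<exists>F\<in>binary_info_structures \<delta>.
    equilibrium_value A uR uS \<pi> F \<le> robust_value + ereal e) (at_right 0)"
proof -
  let ?Q = "Q_set act l uS j" and ?B = "B_matrix uS"
  obtain C where C: "\<forall>i\<in>{1..l}. \<forall>k\<in>{1..l}. u i - u k \<le> C"
    using u_diff_bound by blast
  have "\<exists>q. 0 \<le> q \<and> q \<le> 1 \<and> (\<forall>t\<in>?Q. ereal ((1 - q) * ?B t 1 + q * ?B t 2) \<le> Val_B act l uS j)"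
  proof (cases "?Q = {}")
    case False
    then show ?thesis
      using game_value_two_columns[OF finite_Q_set False, of ?B] by (auto simp: Val_B_def)
  qed (auto intro: exI[of _ 0])
  then obtain q where q: "0 \<le> q" "q \<le> 1"
    "\<And>t. t \<in> ?Q \<Longrightarrow> ereal ((1 - q) * ?B t 1 + q * ?B t 2) \<le> robust_value"
    using robust_value_ge(4) by (meson order_trans)
  \<comment> \<open>The states differ by \<open>h\<^sup>2\<close> only, while both signals keep probability of order \<open>h\<close>; so the
    signals tend to 1/2 even if \<open>q\<close> is 0 or 1.\<close>
  define pr :: "real \<Rightarrow> bool \<Rightarrow> real" where
    "pr h \<omega> = (1 - 2 * h) * q + h + (if \<omega> then h\<^sup>2 else 0)" for h \<omega>
  define lp where "lp h = (1 - \<pi>) * pr h False + \<pi> * pr h True" for h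
  have lim_q: "((\<lambda>h. pr h \<omega>) \<longlongrightarrow> q) (at_right 0)" for \<omega>
    by (cases \<omega>) (auto simp: pr_def intro!: tendsto_eq_intros)
  have "((\<lambda>h. lp h) \<longlongrightarrow> (1 - \<pi>) * q + \<pi> * q) (at_right 0)"
    unfolding lp_def by (intro tendsto_intros lim_q)
  then have lim_lp: "((\<lambda>h. lp h) \<longlongrightarrow> q) (at_right 0)"
    by (simp add: algebra_simps)
  have pr_order: "h \<le> pr h False" "pr h False < pr h True" "h / 2 \<le> 1 - pr h True"
    if "0 < h" "h < 1/2" for h
  proof -
    have "0 \<le> (1 - 2 * h) * q" "0 \<le> (1 - 2 * h) * (1 - q)"
      using that q by simp_all
    moreover have "h * h \<le> h * (1/2)"
      using that by (intro mult_left_mono) auto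
    moreover have "pr h False = (1 - 2 * h) * q + h" "pr h True = pr h False + h * h"
      "1 - pr h True = (1 - 2 * h) * (1 - q) + (h - h * h)"
      by (simp_all add: pr_def power2_eq_square algebra_simps)
    moreover have "0 < h * h" using that by simp
    ultimately show "h \<le> pr h False" "pr h False < pr h True" "h / 2 \<le> 1 - pr h True"
      by linarith+
  qed
  have close: "eventually (\<lambda>h. \<forall>t\<in>?Q. (1 - lp h) * ?B t 1 + lp h * ?B t 2
      < (1 - q) * ?B t 1 + q * ?B t 2 + e) (at_right 0)"
  proof (intro eventually_ball_finite finite_Q_set ballI)
    fix t assume "t \<in> ?Q"
    have "((\<lambda>h. (1 - lp h) * ?B t 1 + lp h * ?B t 2) \<longlongrightarrow> (1 - q) * ?B t 1 + q * ?B t 2) (at_right 0)"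
      by (intro tendsto_intros lim_lp)
    then show "eventually (\<lambda>h. (1 - lp h) * ?B t 1 + lp h * ?B t 2
      < (1 - q) * ?B t 1 + q * ?B t 2 + e) (at_right 0)"
      by (rule order_tendstoD) (use \<open>0 < e\<close> in simp)
  qed
  have "((\<lambda>h. (pr h True - pr h False) * C) \<longlongrightarrow> (q - q) * C) (at_right 0)"
    by (intro tendsto_intros lim_q)
  then have spread: "eventually (\<lambda>h. (pr h True - pr h False) * C < e) (at_right 0)"
    by (rule order_tendstoD) (use \<open>0 < e\<close> in simp)
  have bound: "equilibrium_value A uR uS \<pi> F \<le> robust_value + ereal e"
    if per: "binary_persuasion A act l j uR uS x \<pi> F s0 s1 (pr h) \<delta>"
      and K: "(pr h True - pr h False) * C < e"
      and B: "\<forall>t\<in>?Q. (1 - lp h) * ?B t 1 + lp h * ?B t 2 < (1 - q) * ?B t 1 + q * ?B t 2 + e"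
    for F s0 s1 h \<delta>
    unfolding equilibrium_value_def
  proof (intro SUP_least, clarify)
    interpret binary_persuasion A act l j uR uS x \<pi> F s0 s1 "pr h" \<delta> by fact
    fix M \<sigma> and \<rho> :: "real \<Rightarrow> real \<Rightarrow> 'a pmf"
    assume eq: "cheap_talk_equilibrium A uR uS \<pi> F M \<sigma> \<rho>"
    have weaken: "ereal sp \<le> robust_value + ereal e" if "ereal v \<le> robust_value" "sp \<le> v + e" for sp v
    proof -
      have "ereal sp \<le> ereal v + ereal e" using that by simp
      also have "\<dots> \<le> robust_value + ereal e" using that by (intro add_right_mono)
      finally show ?thesis .
    qed
    from equilibrium_payoff_bound[OF eq C]
    show "ereal (sender_payoff uS \<pi> F M \<sigma> \<rho>) \<le> robust_value + ereal e"
    proof (elim disjE bexE conjE)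
      assume "sender_payoff uS \<pi> F M \<sigma> \<rho> \<le> u j + (pr h True - pr h False) * C"
      then show ?thesis using K by (intro weaken[OF robust_value_ge(1)]) auto
    next
      fix t assume t: "t \<in> ?Q"
        and "sender_payoff uS \<pi> F M \<sigma> \<rho> = (1 - high_signal_prob) * ?B t 1 + high_signal_prob * ?B t 2"
      moreover have "high_signal_prob = lp h" by (simp add: high_signal_prob_def lp_def)
      ultimately show ?thesis
        using B by (intro weaken[OF q(3)[OF t]]) (simp add: less_imp_le)
    next
      assume "T1_set act l uS j \<noteq> {}" "sender_payoff uS \<pi> F M \<sigma> \<rho> \<le> u 1 + (pr h True - pr h False) * C"
      then show ?thesis
        using K robust_value_ge(2) by (intro weaken[of "u 1"]) (auto simp: v_first_def u_def)
    next
      assume "T2_set act l uS j \<noteq> {}" "sender_payoff uS \<pi> F M \<sigma> \<rho> \<le> u l + (pr h True - pr h False) * C"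
      then show ?thesis
        using K robust_value_ge(3) by (intro weaken[of "u l"]) (auto simp: v_last_def u_def)
    qed
  qed
  show ?thesis
    using eventually_binary_persuasion eventually_at_right_less[of 0]
  proof eventually_elim
    case (elim \<delta>)
    have "eventually (\<lambda>h. h < min \<delta> (1/2)) (at_right 0)"
      using elim(2) by (intro eventually_at_rightI[of 0 "min \<delta> (1/2)"]) auto
    from eventually_happens'[OF trivial_limit_at_right_real
        eventually_conj[OF eventually_conj[OF close spread]
          eventually_conj[OF eventually_at_right_less[of 0] this]]]
    obtain h where h: "0 < h" "h < \<delta>" "h < 1/2" "(pr h True - pr h False) * C < e"
      "\<forall>t\<in>?Q. (1 - lp h) * ?B t 1 + lp h * ?B t 2 < (1 - q) * ?B t 1 + q * ?B t 2 + e"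
      by auto
    note pr = pr_order[OF h(1,3)]
    define s0 s1 where "s0 = (1 - pr h True) / (2 - pr h True - pr h False)"
      and "s1 = pr h True / (pr h True + pr h False)"
    have diff: "pr h True = pr h False + h * h"
      by (simp add: pr_def power2_eq_square)
    \<comment> \<open>Here \<open>s1 = 1/2 + h * h / (2 * S)\<close>, and \<open>S\<close> is at
      least \<open>2 * h\<close>, so \<open>s1\<close> exceeds 1/2 by at most
      \<open>h / 4\<close>.\<close>
    define S where "S = pr h True + pr h False"
    have S: "2 * h \<le> S" "0 < S" "2 * pr h True = S + h * h"
      using h(1) pr diff S_def by linarith+
    have "h * (h / 2) \<le> h * S"
      using h S by (intro mult_left_mono) auto
    then have "pr h True \<le> (1/2 + h) * S"
      using S(3) by (simp add: algebra_simps)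
    then have "s1 \<le> 1/2 + h"
      using S(2) by (simp add: s1_def S_def[symmetric] pos_divide_le_eq)
    \<comment> \<open>Likewise \<open>s0 = 1/2 - h * h / (2 * R)\<close> with \<open>R\<close> at
      least \<open>h\<close>, so \<open>s0\<close> falls short of 1/2 by at most
      \<open>h / 2\<close>.\<close>
    define R where "R = 2 - pr h True - pr h False"
    have "h \<le> R" and R: "0 < R"
      using h(1) pr diff R_def by linarith+
    have R_eq: "2 * (1 - pr h True) = R - h * h"
      unfolding R_def diff by (simp add: algebra_simps)
    have "h * (h / 2) \<le> h * R"
      using h \<open>h \<le> R\<close> by (intro mult_left_mono) auto
    then have "(1/2 - h) * R \<le> 1 - pr h True"
      using R_eq by (simp add: algebra_simps)
    then have "1/2 - h \<le> s0"
      using R by (simp add: s0_def R_def[symmetric] pos_le_divide_eq)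
    obtain F where F: "F \<in> binary_info_structures \<delta>" "binary_signals F s0 s1 (pr h)"
      using binary_info_structure_exists[of "pr h" s0 s1 \<delta>] h pr
        \<open>s1 \<le> 1/2 + h\<close> \<open>1/2 - h \<le> s0\<close> by (auto simp: s0_def s1_def)
    have "binary_persuasion A act l j uR uS x \<pi> F s0 s1 (pr h) \<delta>"
      using elim(1) F(2) h \<open>s1 \<le> 1/2 + h\<close> \<open>1/2 - h \<le> s0\<close> by simp
    then show ?case
      using bound[OF _ h(4,5)] F(1) by blast
  qed
qed

lemma binary_robust_value_eq: "binary_robust_value A uR uS \<pi> = robust_value"
proof (rule antisym)
  let ?f = "\<lambda>\<delta>. INF F \<in> binary_info_structures \<delta>. equilibrium_value A uR uS \<pi> F"
  note lim = binary_robust_value_tendsto[of A uR uS \<pi>]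
  show "robust_value \<le> binary_robust_value A uR uS \<pi>"
  proof (rule tendsto_lowerbound[OF lim])
    show "eventually (\<lambda>\<delta>. robust_value \<le> ?f \<delta>) (at_right 0)"
      using eventually_binary_persuasion
    proof eventually_elim
      case (elim \<delta>)
      show ?case
      proof (rule INF_greatest)
        fix F assume "F \<in> binary_info_structures \<delta>"
        then obtain s0 s1 p where "binary_signals F s0 s1 p" "1/2 - \<delta> \<le> s0" "s1 \<le> 1/2 + \<delta>"
          using binary_signals_exists by blast
        then show "robust_value \<le> equilibrium_value A uR uS \<pi> F"
          using elim robust_value_le_equilibrium_value by blast
      qed
    qed
  qed simp
  show "binary_robust_value A uR uS \<pi> \<le> robust_value"
  proof (rule ereal_le_epsilon2)
    fix e :: real assume "0 < e"
    show "binary_robust_value A uR uS \<pi> \<le> robust_value + ereal e"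
    proof (rule tendsto_upperbound[OF lim])
      show "eventually (\<lambda>\<delta>. ?f \<delta> \<le> robust_value + ereal e) (at_right 0)"
        using equilibrium_value_le_robust_value[OF \<open>0 < e\<close>]
        by eventually_elim (meson INF_lower2)
    qed simp
  qed
qed

end

theorem theorem3:
  fixes A :: "'a set" and act :: "nat \<Rightarrow> 'a" and l j :: nat
    and uR :: "'a \<Rightarrow> bool \<Rightarrow> real" and uS :: "'a \<Rightarrow> real"
    and x :: "nat \<Rightarrow> real" and \<pi> :: real
  assumes "bij_betw act {1..l} A"
    and "x 0 = 0" and "x l = 1" and "strict_mono_on {0..l} x"
    and "\<And>i. i \<in> {1..l} \<Longrightarrow> {b \<in> {0..1}. act i \<in> optimal_actions A uR b} = {x (i - 1)..x i}"
    and "inj_on uS A"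
    and "0 < \<pi>" and "\<pi> < 1"
    and "j \<in> {1..l}" and "\<pi> \<in> interior {x (j - 1)..x j}"
  shows "binary_robust_value A uR uS \<pi> =
           Max {v_first act l uS j, v_last act l uS j, Val_B act l uS j, ereal (uS (act j))}"
proof -
  interpret cheap_talk_model A act l j uR uS x \<pi>
    by (rule cheap_talk_model.intro) (fact assms)+
  show ?thesis
    using binary_robust_value_eq by (simp only: robust_value_def u_def)
qed

end
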